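(* Let $\lambda>0$, $\sigma>0$, $0<\alpha_1\le1$, $0<\beta\le1$. Let $\{N_{\alpha_1,1}(t_1,t_2),\ (t_1,t_2)\in\mathbb{R}^2_+\}$ be the fractional Poisson random field with parameter $\lambda$ and indices $\alpha_1$ and $\alpha_2=1$, and let $Y_1^\beta,Y_2^\beta,\dots$ be iid random variables, independent of this field, with common density $f_{Y^\beta}(y)=\sigma y^{\beta-1}E_{\beta,\beta}(-\sigma y^\beta)$ for $y>0$ and $0$ for $y<0$ (here $\beta$ in $Y_j^\beta$ is a superscript label, not a power). Let $\mathscr{Y}_{\alpha_1,1}^\beta(t_1,t_2)=\sum_{j=1}^{N_{\alpha_1,1}(t_1,t_2)}Y_j^\beta$. Then, for $y\ge0$ and $(t_1,t_2)\in\mathbb{R}^2_+$, $$\mathrm{Pr}\{\mathscr{Y}_{\alpha_1,1}^\beta(t_1,t_2)\leq y\}=E_{\alpha_1,1}(-\lambda t_1^{\alpha_1}t_2)\mathbf{1}_{[0,\infty)}(y)+\int_{-\infty}^{y}f_{\mathscr{Y}_{\alpha_1,1}^\beta}(x,t_1,t_2)\,\mathrm{d}x,$$ where $f_{\mathscr{Y}_{\alpha_1,1}^\beta}(y,t_1,t_2)=0$ for $y<0$ and, for $y>0$, $$f_{\mathscr{Y}_{\alpha_1,1}^\beta}(y,t_1,t_2)=\frac{1}{y}\sum_{n=1}^{\infty}(\lambda\sigma t_1^{\alpha_1}t_2y^\beta)^nE_{\alpha_1,\alpha_1 n+1}^{n+1}(-\lambda t_1^{\alpha_1}t_2)E_{\beta,\beta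 n}^n(-\sigma y^\beta).$$ It solves $$\sigma\frac{\partial^{\alpha_1}}{\partial t_1^{\alpha_1}}f_{\mathscr{Y}_{\alpha_1,1}^\beta}(y,t_1,t_2)=-\bigg(\lambda t_2+\frac{\partial^{\alpha_1}}{\partial t_1^{\alpha_1}}\bigg)\frac{\partial^\beta}{\partial y^\beta}f_{\mathscr{Y}_{\alpha_1,1}^\beta}(y,t_1,t_2),$$ with $f_{\mathscr{Y}_{\alpha_1,1}^\beta}(y,0,t_2)=0$, where $\frac{\partial^{\alpha_1}}{\partial t_1^{\alpha_1}}$ and $\frac{\partial^\beta}{\partial y^\beta}$ are Caputo fractional derivatives. Also, $$\int_{0}^{\infty}f_{\mathscr{Y}_{\alpha_1,1}^\beta}(y,t_1,t_2)\,\mathrm{d}y=1-E_{\alpha_1,1}(-\lambda t_1^{\alpha_1}t_2).$$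
   Context: $\mathbb{R}_+=[0,\infty)$. An empty sum is $0$. Fractional Poisson random field with parameter $\lambda>0$ and indices $0<\alpha_1,\alpha_2\le1$: a nonnegative-integer-valued random field $\{N_{\alpha_1,\alpha_2}(t_1,t_2)\}$ on $\mathbb{R}^2_+$ whose one-point distribution $p_{\alpha_1,\alpha_2}(n,t_1,t_2)=\mathrm{Pr}\{N_{\alpha_1,\alpha_2}(t_1,t_2)=n\}$, $n\ge0$, solves $$\frac{\partial^{\alpha_1+\alpha_2}}{\partial t_2^{\alpha_2}\partial t_1^{\alpha_1}}p_{\alpha_1,\alpha_2}(n,t_1,t_2)=(n+1)\lambda p_{\alpha_1,\alpha_2}(n+1,t_1,t_2)-(2n+1)\lambda p_{\alpha_1,\alpha_2}(n,t_1,t_2)+n\lambda p_{\alpha_1,\alpha_2}(n-1,t_1,t_2)$$ (Caputo derivatives) with $p_{\alpha_1,\alpha_2}(0,0,0)=p_{\alpha_1,\alpha_2}(0,t_1,0)=p_{\alpha_1,\alpha_2}(0,0,t_2)=1$. It is known (and may be used) that $$p_{\alpha_1,\alpha_2}(n,t_1,t_2)=\sum_{k=n}^{\infty}\frac{(-1)^{k-n}(k)_{k-n}(k)_n(\lambda t_1^{\alpha_1}t_2^{\alpha_2})^k}{\Gamma(k\alpha_1+1)\Gamma(k\alpha_2+1)},\quad (k)_n=k(k-1)\cdots(k-n+1),\ (k)_0=1;$$ here it is applied with $\alpha_2=1$. Three-parameter Mittag-Leffler function: $E_{\alpha,\beta}^{\gamma}(x)=\sum_{k=0}^\infty\frac{\gamma^{(k)}x^k}{\Gamma(\alpha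 k+\beta)k!}$, $\gamma^{(k)}=\gamma(\gamma+1)\cdots(\gamma+k-1)$, and $E_{\alpha,\beta}=E_{\alpha,\beta}^1$. Caputo derivative of order $\alpha\in(0,1]$ of a function $g$: $\frac{\mathrm{d}^\alpha}{\mathrm{d}t^\alpha}g(t)=\frac{1}{\Gamma(1-\alpha)}\int_0^t\frac{g'(s)}{(t-s)^\alpha}\,\mathrm{d}s$ for $0<\alpha<1$, and $g'(t)$ for $\alpha=1$; it is applied in the variable $t_1$ with order $\alpha_1$ and in the variable $y$ with order $\beta$.
   Formalization: For β<1 the density behaves like y^{β-1} at 0, so the Caputo integral in y diverges; the y-derivative is instead taken as d/dy of the order 1-β fractional integral of f, with f(0)=0 (Riemann–Liouville form), and the equation is stated for y>0, t_1>0. *)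

theory Defs
  imports "HOL-Probability.Probability"
begin

text \<open>Falling factorial \<open>(k)\<^sub>m = k (k - 1) \<dots> (k - m + 1)\<close>, with \<open>(k)\<^sub>0 = 1\<close>.\<close>

definition falling :: "nat \<Rightarrow> nat \<Rightarrow> real" where
  "falling k m = (\<Prod>i<m. real k - real i)"

definition mittag_leffler3 :: "real \<Rightarrow> real \<Rightarrow> real \<Rightarrow> real \<Rightarrow> real" where
  "mittag_leffler3 \<alpha> \<beta> \<gamma> x =
     (\<Sum>k. pochhammer \<gamma> k * x ^ k / (Gamma (\<alpha> * real k + \<beta>) * fact k))"

definition mittag_leffler :: "real \<Rightarrow> real \<Rightarrow> real \<Rightarrow> real" where
  "mittag_leffler \<alpha> \<beta> x = mittag_leffler3 \<alpha> \<beta> 1 x"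

text \<open>
  The Caputo derivative of order \<open>0 < \<alpha> \<le> 1\<close>.  The library integral of a non-integrable
  function is \<open>0\<close>, and \<open>deriv\<close> is arbitrary where there is no derivative, so
  \<open>caputo_exists\<close> says separately that the value is meaningful.
\<close>

definition caputo :: "real \<Rightarrow> (real \<Rightarrow> real) \<Rightarrow> real \<Rightarrow> real" where
  "caputo \<alpha> g t =
     (if \<alpha> = 1 then deriv g t
      else 1 / Gamma (1 - \<alpha>) * (LBINT s:{0<..<t}. deriv g s / (t - s) powr \<alpha>))"

definition caputo_exists :: "real \<Rightarrow> (real \<Rightarrow> real) \<Rightarrow> real \<Rightarrow> bool" where
  "caputo_exists \<alpha> g t \<longleftrightarrow>
     (if \<alpha> = 1 then g field_differentiable at t
      else (\<forall>s\<in>{0<..<t}. g field_differentiable at s) \<and>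
           set_integrable lborel {0<..<t} (\<lambda>s. deriv g s / (t - s) powr \<alpha>))"

text \<open>
  For \<open>0 < \<alpha> < 1\<close> the integral in \<open>caputo\<close> diverges when \<open>g\<close> behaves like
  \<open>s powr (\<alpha> - 1)\<close> near \<open>0\<close>, as the density below does in its space variable.  For such
  functions the Caputo derivative is taken in the standard extended form
  (Kilbas, Srivastava and Trujillo, \<^emph>\<open>Theory and Applications of Fractional
  Differential Equations\<close>, Section 2.4)
  \<open>(d/dt) (1 / Gamma (1 - \<alpha>)) \<integral>\<^sub>0\<^sup>t (g s - g 0) / (t - s) powr \<alpha> ds\<close>,
  i.e. the Riemann-Liouville derivative of \<open>g - g 0\<close>.  If \<open>g\<close> is
  continuous on \<open>[0, T]\<close> and continuously differentiable on \<open>(0, T)\<close> with integrable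
  derivative, this is \<open>caputo \<alpha> g t\<close> for \<open>0 < t < T\<close>.  The value \<open>g 0\<close> matters when
  \<open>g\<close> is not right-continuous at \<open>0\<close>.
\<close>

definition caputo_ext :: "real \<Rightarrow> (real \<Rightarrow> real) \<Rightarrow> real \<Rightarrow> real" where
  "caputo_ext \<alpha> g t =
     (if \<alpha> = 1 then deriv g t
      else deriv (\<lambda>u. 1 / Gamma (1 - \<alpha>) *
             (LBINT s:{0<..<u}. (g s - g 0) / (u - s) powr \<alpha>)) t)"

definition caputo_ext_exists :: "real \<Rightarrow> (real \<Rightarrow> real) \<Rightarrow> real \<Rightarrow> bool" where
  "caputo_ext_exists \<alpha> g t \<longleftrightarrow>
     (if \<alpha> = 1 then g field_differentiable at t
      else (\<forall>u>0. set_integrable lborel {0<..<u} (\<lambda>s. (g s - g 0) / (u - s) powr \<alpha>)) \<and>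
           (\<lambda>u. 1 / Gamma (1 - \<alpha>) *
             (LBINT s:{0<..<u}. (g s - g 0) / (u - s) powr \<alpha>)) field_differentiable at t)"

text \<open>
  In the equation for \<open>n = 0\<close> the truncated \<open>n - 1\<close> is harmless because of its factor \<open>n\<close>.
\<close>

definition fractional_poisson_field ::
  "'a measure \<Rightarrow> real \<Rightarrow> real \<Rightarrow> real \<Rightarrow> (real \<Rightarrow> real \<Rightarrow> 'a \<Rightarrow> nat) \<Rightarrow> bool" where
  "fractional_poisson_field M lam \<alpha>1 \<alpha>2 N \<longleftrightarrow>
     (\<forall>t1\<ge>0. \<forall>t2\<ge>0. N t1 t2 \<in> measurable M (count_space UNIV)) \<and>
     (let p = (\<lambda>n t1 t2. measure M {\<omega> \<in> space M. N t1 t2 \<omega> = n}) in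
       (\<forall>n. \<forall>t1>0. \<forall>t2>0.
          (\<forall>s2>0. caputo_exists \<alpha>1 (\<lambda>s1. p n s1 s2) t1) \<and>
          caputo_exists \<alpha>2 (\<lambda>s2. caputo \<alpha>1 (\<lambda>s1. p n s1 s2) t1) t2 \<and>
          caputo \<alpha>2 (\<lambda>s2. caputo \<alpha>1 (\<lambda>s1. p n s1 s2) t1) t2 =
            (real n + 1) * lam * p (n + 1) t1 t2 - (2 * real n + 1) * lam * p n t1 t2
              + real n * lam * p (n - 1) t1 t2) \<and>
       p 0 0 0 = 1 \<and> (\<forall>t1\<ge>0. p 0 t1 0 = 1) \<and> (\<forall>t2\<ge>0. p 0 0 t2 = 1))"

text \<open>The series over \<open>k \<ge> n\<close> is summed over \<open>j = k - n\<close>.\<close>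

definition fractional_poisson_prob ::
  "real \<Rightarrow> real \<Rightarrow> real \<Rightarrow> nat \<Rightarrow> real \<Rightarrow> real \<Rightarrow> real" where
  "fractional_poisson_prob lam \<alpha>1 \<alpha>2 n t1 t2 =
     (\<Sum>j. let k = n + j in
        (-1) ^ (k - n) * falling k (k - n) * falling k n * (lam * t1 powr \<alpha>1 * t2 powr \<alpha>2) ^ k
          / (Gamma (real k * \<alpha>1 + 1) * Gamma (real k * \<alpha>2 + 1)))"

text \<open>
  \<open>ennreal\<close> maps negative numbers to \<open>0\<close>; without the nonnegativity, \<open>distributed\<close> would
  only say that the positive part of \<open>f\<close> is a density.
\<close>

definition has_real_density :: "'a measure \<Rightarrow> ('a \<Rightarrow> real) \<Rightarrow> (real \<Rightarrow> real) \<Rightarrow> bool" where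
  "has_real_density M X f \<longleftrightarrow>
     (AE x in lborel. 0 \<le> f x) \<and> distributed M lborel X (\<lambda>x. ennreal (f x))"

definition jump_density :: "real \<Rightarrow> real \<Rightarrow> real \<Rightarrow> real" where
  "jump_density \<sigma> \<beta> y =
     (if 0 < y then \<sigma> * y powr (\<beta> - 1) * mittag_leffler \<beta> \<beta> (- \<sigma> * y powr \<beta>) else 0)"

text \<open>The field as a single random element, indexed by \<open>[0, \<infinity>) \<times> [0, \<infinity>)\<close>.\<close>

definition field_path :: "(real \<Rightarrow> real \<Rightarrow> 'a \<Rightarrow> nat) \<Rightarrow> 'a \<Rightarrow> real \<times> real \<Rightarrow> nat" where
  "field_path N \<omega> = (\<lambda>t\<in>{0..} \<times> {0..}. N (fst t) (snd t) \<omega>)"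

definition compound_field ::
  "(real \<Rightarrow> real \<Rightarrow> 'a \<Rightarrow> nat) \<Rightarrow> (nat \<Rightarrow> 'a \<Rightarrow> real) \<Rightarrow> real \<Rightarrow> real \<Rightarrow> 'a \<Rightarrow> real" where
  "compound_field N Y t1 t2 \<omega> = (\<Sum>j = 1..N t1 t2 \<omega>. Y j \<omega>)"

definition compound_density_term ::
  "real \<Rightarrow> real \<Rightarrow> real \<Rightarrow> real \<Rightarrow> real \<Rightarrow> real \<Rightarrow> real \<Rightarrow> nat \<Rightarrow> real" where
  "compound_density_term lam \<sigma> \<alpha>1 \<beta> y t1 t2 n =
     (lam * \<sigma> * t1 powr \<alpha>1 * t2 * y powr \<beta>) ^ n
       * mittag_leffler3 \<alpha>1 (\<alpha>1 * real n + 1) (real n + 1) (- lam * t1 powr \<alpha>1 * t2)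
       * mittag_leffler3 \<beta> (\<beta> * real n) (real n) (- \<sigma> * y powr \<beta>)"

text \<open>
  The value at \<open>y = 0\<close>, a null set, is the limit \<open>0\<close> from the left; it is the
  \<open>g 0\<close> of \<open>caputo_ext\<close>.
\<close>

definition compound_density ::
  "real \<Rightarrow> real \<Rightarrow> real \<Rightarrow> real \<Rightarrow> real \<Rightarrow> real \<Rightarrow> real \<Rightarrow> real" where
  "compound_density lam \<sigma> \<alpha>1 \<beta> y t1 t2 =
     (if 0 < y
      then 1 / y * (\<Sum>n. compound_density_term lam \<sigma> \<alpha>1 \<beta> y t1 t2 (Suc n))
      else 0)"

end

theory Submission
  imports Defs
begin

text \<open>
  Everything is expressed through the kernels \<open>u\<^sup>r\<^sup>-\<^sup>1 / \<Gamma>(r)\<close>, which form a convolution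
  semigroup and whose derivative lowers \<open>r\<close> by one.  A series of such kernels with exponents
  \<open>c k + e\<close> and geometrically bounded coefficients may therefore be differentiated, convolved
  and fractionally integrated term by term; a Caputo derivative of order \<open>c\<close> merely shifts its
  coefficients.  The density of \<open>n\<close> jumps is such a series, the density of the field is their
  mixture, and expanding it in both variables gives coefficients
  \<open>(-1)\<^sup>m\<^sup>+\<^sup>l\<^sup>+\<^sup>1 (m + l choose l + 1)\<close>, for which the fractional differential equation is
  Pascal's rule.  Nonnegativity of the weights and of the jump density is not computed: both
  are probabilities by hypothesis.
\<close>

section \<open>Series in powers with Gamma denominators\<close>

text \<open>Time and space call for different leading indices. A weight is continuous in t1 and its
  series starts with the constant kernel, \<open>e = 1\<close>. A density behaves like y^(\<beta>-1)
  at the origin, so its series starts at \<open>e = \<beta>\<close>. In t1 one can therefore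
  differentiate and then integrate fractionally. In y, for \<beta> < 1, the derivative of the
  leading term is not integrable at 0, so the order is reversed: the fractional integral of order 1
  - \<beta> turns that term into a constant, which the derivative removes.

  Two kinds of exchange of limits are kept apart. At a fixed point (t1, y), crude absolute bounds
  suffice, because 1/Gamma decays faster than any geometric sequence. Such bounds fail for integrals
  over a half-line, where no kernel of positive index is integrable. There the sum over the number
  of jumps is taken outside the integral by nonnegativity and by total masses of at most 1, which is
  why the signs matter.\<close>

text \<open>At \<open>r = 0\<close> the kernel is \<open>0\<close>, because \<open>rGamma 0 = 0\<close>; this makes the derivative rule
  below hold for the constant kernel with index \<open>1\<close> as well.\<close>

definition rl_kernel :: "real \<Rightarrow> real \<Rightarrow> real" where
  "rl_kernel r u = u powr (r - 1) * rGamma r"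

text \<open>This growth is beaten by 1/Gamma, whatever the rate, and the class is stable under index
  shifts and Cauchy products.\<close>

definition geom_bounded :: "(nat \<Rightarrow> real) \<Rightarrow> bool" where
  "geom_bounded d \<longleftrightarrow> (\<exists>C\<ge>0. \<exists>R\<ge>0. \<forall>k. \<bar>d k\<bar> \<le> C * R ^ k)"

text \<open>\<open>e\<close> is the index of the first kernel. It is \<open>1\<close> for series in
  time and the jump index for densities in space; other values arise in between.\<close>

definition frac_series :: "real \<Rightarrow> real \<Rightarrow> (nat \<Rightarrow> real) \<Rightarrow> real \<Rightarrow> real" where
  "frac_series c e d u = (\<Sum>k. d k * rl_kernel (c * real k + e) u)"

lemma rGamma_real_nonneg: "0 \<le> (x::real) \<Longrightarrow> 0 \<le> rGamma x"
  by (cases "x = 0") (auto simp: rGamma_inverse_Gamma)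

lemma rl_kernel_nonneg: "0 \<le> r \<Longrightarrow> 0 \<le> rl_kernel r u"
  by (simp add: rl_kernel_def rGamma_real_nonneg)

lemma rl_kernel_measurable [measurable]: "rl_kernel r \<in> borel_measurable borel"
  unfolding rl_kernel_def by measurable

lemma frac_series_measurable [measurable]: "frac_series c e d \<in> borel_measurable borel"
  unfolding frac_series_def by measurable

text \<open>Only the part of Euler's integral over t >= T is kept, where t^(x-1) is at least
  T^(x-1). The free parameter \<open>T\<close> lets the bound outgrow any prescribed geometric
  rate.\<close>

lemma Gamma_real_lower_bound:
  assumes "1 \<le> x" "0 < T"
  shows "T powr (x - 1) * exp (- T) \<le> Gamma (x::real)"
proof -
  have 1: "((\<lambda>t. exp (-1 * t)) has_integral exp (-1 * T) / 1) {T..}"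
    by (rule has_integral_exp_minus_to_infinity) simp
  have 2: "((\<lambda>t. T powr (x - 1) * exp (-1 * t)) has_integral T powr (x - 1) * (exp (-1 * T) / 1)) {T..}"
    by (rule has_integral_mult_right[OF 1])
  have 3: "((\<lambda>t. if t \<in> {T..} then T powr (x - 1) * exp (-1 * t) else 0)
      has_integral T powr (x - 1) * (exp (-1 * T) / 1)) {0..}"
    by (subst has_integral_restrict) (use 2 assms in auto)
  have "T powr (x - 1) * (exp (-1 * T) / 1) \<le> Gamma x"
  proof (rule has_integral_le[OF 3 Gamma_integral_real])
    fix t :: real
    assume "t \<in> {0..}"
    show "(if t \<in> {T..} then T powr (x - 1) * exp (-1 * t) else 0) \<le> t powr (x - 1) / exp t"
      using assms by (auto simp: exp_minus field_simps intro!: powr_mono2)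
  qed (use assms in auto)
  then show ?thesis by simp
qed

lemma rGamma_real_upper_bound:
  assumes "1 \<le> x" "0 < T"
  shows "rGamma (x::real) \<le> exp T * T powr (1 - x)"
proof -
  have "rGamma x \<le> inverse (T powr (x - 1) * exp (- T))"
    unfolding rGamma_inverse_Gamma
    by (intro le_imp_inverse_le Gamma_real_lower_bound assms) (use assms in auto)
  also have "\<dots> = exp T * T powr (1 - x)"
    by (simp add: exp_minus powr_minus[symmetric])
  finally show ?thesis .
qed

lemma summable_geometric_rl_kernel:
  assumes c: "0 < c" and e: "0 \<le> e" and u: "0 < u" and R: "0 \<le> R"
  shows "summable (\<lambda>k. R ^ k * rl_kernel (c * real k + e) u)"
proof -
  \<comment> \<open>Chosen so that T^c = 2 (R + 1) u^c. The k-th summand then carries the k-th power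
    of R u^c / T^c = R / (2 (R + 1)), which is at most 1/2. The \<open>+ 1\<close> keeps
    \<open>T\<close> positive when R = 0.\<close>
  define T where "T = (2 * (R + 1) * u powr c) powr (1 / c)"
  have T: "0 < T" using assms by (simp add: T_def)
  have Tc: "T powr c = 2 * (R + 1) * u powr c"
    using assms by (simp add: T_def powr_powr)
  define B where "B = exp T * u powr (e - 1) * T powr (1 - e)"
  \<comment> \<open>From \<open>k0\<close> on, the argument of 1/Gamma is at least 1, as its upper
    bound requires.\<close>
  obtain k0 :: nat where k0: "1 \<le> c * real k0"
    using reals_Archimedean3[OF c] by (metis less_imp_le mult.commute)
  show ?thesis
  proof (rule summable_comparison_test)
    show "summable (\<lambda>k. B * (1 / 2) ^ k)"
      by (intro summable_mult summable_geometric) simp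
    show "\<exists>N. \<forall>k\<ge>N. norm (R ^ k * rl_kernel (c * real k + e) u) \<le> B * (1 / 2) ^ k"
    proof (intro exI allI impI)
      fix k assume "k0 \<le> k"
      then have "c * real k0 \<le> c * real k" using c by simp
      with k0 e have k1: "1 \<le> c * real k + e" by linarith
      have pw: "x powr (c * real k) = (x powr c) ^ k" if "0 < x" for x :: real
        using that by (simp add: powr_powr[symmetric] powr_realpow)
      have "R ^ k * rl_kernel (c * real k + e) u
          \<le> R ^ k * (u powr (c * real k + e - 1) * (exp T * T powr (1 - (c * real k + e))))"
        unfolding rl_kernel_def
        by (intro mult_left_mono rGamma_real_upper_bound k1 T) (use R in auto)
      also have "u powr (c * real k + e - 1) = u powr (e - 1) * (u powr c) ^ k"
        using u by (simp add: pw[symmetric] powr_add[symmetric] algebra_simps)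
      also have "T powr (1 - (c * real k + e)) = T powr (1 - e) / (T powr c) ^ k"
        using T by (simp add: pw[symmetric] powr_diff[symmetric] algebra_simps)
      also have "R ^ k * (u powr (e - 1) * (u powr c) ^ k * (exp T * (T powr (1 - e) / (T powr c) ^ k)))
          = B * (R / (2 * (R + 1))) ^ k"
      proof -
        have "(u powr c) ^ k / (2 * (R + 1) * u powr c) ^ k = 1 / (2 * (R + 1)) ^ k"
          using u by (subst power_mult_distrib) simp
        then have "R ^ k * (u powr (e - 1) * exp T * T powr (1 - e)) * ((u powr c) ^ k / (2 * (R + 1) * u powr c) ^ k)
            = R ^ k * (u powr (e - 1) * exp T * T powr (1 - e)) * (1 / (2 * (R + 1)) ^ k)"
          by simp
        then show ?thesis
          unfolding Tc B_def power_divide by (simp add: mult_ac)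
      qed
      also have "\<dots> \<le> B * (1 / 2) ^ k"
        using R by (intro mult_left_mono power_mono) (auto simp: B_def field_simps)
      finally show "norm (R ^ k * rl_kernel (c * real k + e) u) \<le> B * (1 / 2) ^ k"
        using R c e by (simp add: abs_mult rl_kernel_nonneg)
    qed
  qed
qed

section \<open>Stability of geometric coefficient bounds\<close>

lemma geom_boundedI: "(\<And>k. \<bar>d k\<bar> \<le> C * R ^ k) \<Longrightarrow> 0 \<le> C \<Longrightarrow> 0 \<le> R \<Longrightarrow> geom_bounded d"
  unfolding geom_bounded_def by blast

lemma geom_bounded_Suc:
  assumes "geom_bounded d"
  shows "geom_bounded (\<lambda>k. d (Suc k))"
proof -
  obtain C R where "0 \<le> C" "0 \<le> R" "\<And>k. \<bar>d k\<bar> \<le> C * R ^ k"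
    using assms unfolding geom_bounded_def by blast
  then show ?thesis
    by (intro geom_boundedI[of _ "C * R" R]) (auto simp: mult.assoc power_Suc[symmetric] simp del: power_Suc)
qed

lemma geom_bounded_abs: "geom_bounded d \<Longrightarrow> geom_bounded (\<lambda>k. \<bar>d k\<bar>)"
  unfolding geom_bounded_def by simp

lemma geom_bounded_cmult:
  assumes "geom_bounded d"
  shows "geom_bounded (\<lambda>k. q * d k)"
proof -
  obtain C R where "0 \<le> C" "0 \<le> R" "\<And>k. \<bar>d k\<bar> \<le> C * R ^ k"
    using assms unfolding geom_bounded_def by blast
  then show ?thesis
    by (intro geom_boundedI[of _ "\<bar>q\<bar> * C" R]) (auto simp: abs_mult mult.assoc intro!: mult_left_mono)
qed

text \<open>Each product term is at most C' C max(R, R')^k, and the number k + 1 of terms is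
  absorbed by doubling the rate.\<close>

lemma geom_bounded_Cauchy_product:
  assumes "geom_bounded d" "geom_bounded d'"
  shows "geom_bounded (\<lambda>k. \<Sum>i\<le>k. d' i * d (k - i))"
proof -
  obtain C R where d: "0 \<le> C" "0 \<le> R" "\<And>k. \<bar>d k\<bar> \<le> C * R ^ k"
    using assms(1) unfolding geom_bounded_def by blast
  obtain C' R' where d': "0 \<le> C'" "0 \<le> R'" "\<And>k. \<bar>d' k\<bar> \<le> C' * R' ^ k"
    using assms(2) unfolding geom_bounded_def by blast
  show ?thesis
  proof (rule geom_boundedI)
    fix k
    have "\<bar>\<Sum>i\<le>k. d' i * d (k - i)\<bar> \<le> (\<Sum>i\<le>k. \<bar>d' i * d (k - i)\<bar>)"
      by (rule sum_abs)
    also have "\<dots> \<le> (\<Sum>i\<le>k. (C' * R' ^ i) * (C * R ^ (k - i)))"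
      unfolding abs_mult by (intro sum_mono mult_mono d d') (use d d' in auto)
    also have "\<dots> \<le> (\<Sum>i\<le>k. C' * C * (max R R') ^ k)"
    proof (intro sum_mono)
      fix i assume "i \<in> {..k}"
      then have "R' ^ i * R ^ (k - i) \<le> (max R R') ^ i * (max R R') ^ (k - i)"
        using d d' by (intro mult_mono power_mono) auto
      also have "\<dots> = (max R R') ^ k" using \<open>i \<in> {..k}\<close> by (simp add: power_add[symmetric])
      finally show "(C' * R' ^ i) * (C * R ^ (k - i)) \<le> C' * C * (max R R') ^ k"
        using d d' mult_left_mono[of "R' ^ i * R ^ (k - i)" "(max R R') ^ k" "C' * C"]
        by (simp add: mult_ac)
    qed
    also have "\<dots> = C' * C * (real (Suc k) * (max R R') ^ k)" by (simp add: algebra_simps)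
    also have "\<dots> \<le> C' * C * (2 ^ k * (max R R') ^ k)"
    proof -
      have "Suc k \<le> 2 ^ k" by (induction k) auto
      then have "real (Suc k) \<le> 2 ^ k" by (metis of_nat_le_iff of_nat_numeral of_nat_power)
      then show ?thesis using d d' by (intro mult_left_mono mult_right_mono) auto
    qed
    finally show "\<bar>\<Sum>i\<le>k. d' i * d (k - i)\<bar> \<le> C' * C * (2 * max R R') ^ k"
      by (simp add: power_mult_distrib)
  qed (use d d' in auto)
qed

lemma summable_frac_series:
  assumes "geom_bounded d" "0 < c" "0 \<le> e" "0 < u"
  shows "summable (\<lambda>k. \<bar>d k * rl_kernel (c * real k + e) u\<bar>)"
    and "summable (\<lambda>k. \<bar>d k\<bar> * rl_kernel (c * real k + e) u)"
    and "summable (\<lambda>k. d k * rl_kernel (c * real k + e) u)"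
proof -
  obtain C R where d: "0 \<le> C" "0 \<le> R" "\<And>k. \<bar>d k\<bar> \<le> C * R ^ k"
    using assms(1) unfolding geom_bounded_def by blast
  have "summable (\<lambda>k. C * (R ^ k * rl_kernel (c * real k + e) u))"
    by (intro summable_mult summable_geometric_rl_kernel assms d)
  then show 1: "summable (\<lambda>k. \<bar>d k * rl_kernel (c * real k + e) u\<bar>)"
    by (rule summable_comparison_test_ev[rotated], intro always_eventually allI)
      (use d assms in \<open>auto simp: abs_mult rl_kernel_nonneg mult.assoc[symmetric] intro!: mult_right_mono\<close>)
  then show "summable (\<lambda>k. d k * rl_kernel (c * real k + e) u)"
    by (rule summable_rabs_cancel)
  from 1 show "summable (\<lambda>k. \<bar>d k\<bar> * rl_kernel (c * real k + e) u)"
    using assms by (simp add: abs_mult rl_kernel_nonneg)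
qed

section \<open>Termwise differentiation and convolution\<close>

lemma rl_kernel_has_derivative:
  assumes "0 \<le> r" "0 < u"
  shows "(rl_kernel (r + 1) has_real_derivative rl_kernel r u) (at u)"
proof -
  have "((\<lambda>u. u powr r * rGamma (r + 1)) has_real_derivative r * u powr (r - 1) * rGamma (r + 1)) (at u)"
    using assms by (auto intro!: derivative_eq_intros)
  moreover have "r * u powr (r - 1) * rGamma (r + 1) = rl_kernel r u"
    unfolding rl_kernel_def rGamma_plus1[of r, symmetric] by simp
  ultimately show ?thesis by (simp add: rl_kernel_def[abs_def])
qed

lemma frac_series_has_derivative:
  assumes d: "geom_bounded d" and c: "0 < c" and e: "0 \<le> e" and u: "0 < u"
  shows "(frac_series c (e + 1) d has_real_derivative frac_series c e d u) (at u)"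
proof -
  define S where "S = {u / 2<..<2 * u}"
  have S: "convex S" "u \<in> S" "open S" using u by (auto simp: S_def)
  \<comment> \<open>The kernel decreases for r < 1 and increases for r > 1, so neither end of the
    interval dominates it for all r. Writing it as v^r / v and bounding numerator and denominator
    separately costs the factor 4.\<close>
  have dom: "rl_kernel r v \<le> 4 * rl_kernel r (2 * u)" if "0 \<le> r" "v \<in> S" for r v
  proof -
    have v: "u / 2 < v" "v < 2 * u" "0 < v" using that u by (auto simp: S_def)
    have "v powr (r - 1) = v powr r / v" using v by (simp add: powr_diff)
    also have "\<dots> \<le> (2 * u) powr r / (u / 2)"
      using v u that by (intro frac_le powr_mono2) auto
    also have "\<dots> = 4 * (2 * u) powr (r - 1)" using u by (simp add: powr_diff)
    finally show ?thesis unfolding rl_kernel_def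
      by (metis mult.assoc mult_right_mono rGamma_real_nonneg that(1))
  qed
  have "((\<lambda>v. \<Sum>k. d k * rl_kernel (c * real k + e + 1) v) has_real_derivative
      (\<Sum>k. d k * rl_kernel (c * real k + e) u)) (at u)"
  proof (rule has_field_derivative_series'(2)[where S = S])
    fix n v assume "v \<in> S"
    then have v: "0 < v" using u by (simp add: S_def)
    show "((\<lambda>v. d n * rl_kernel (c * real n + e + 1) v) has_real_derivative
      d n * rl_kernel (c * real n + e) v) (at v within S)"
      using c e v by (intro DERIV_cmult has_field_derivative_at_within[OF rl_kernel_has_derivative]) auto
  next
    show "uniformly_convergent_on S (\<lambda>n v. \<Sum>i<n. d i * rl_kernel (c * real i + e) v)"
    proof (rule Weierstrass_m_test')
      show "summable (\<lambda>k. 4 * (\<bar>d k\<bar> * rl_kernel (c * real k + e) (2 * u)))"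
        by (intro summable_mult summable_frac_series) (use assms in auto)
      fix n v assume "v \<in> S"
      then show "norm (d n * rl_kernel (c * real n + e) v) \<le> 4 * (\<bar>d n\<bar> * rl_kernel (c * real n + e) (2 * u))"
        using c e dom[of "c * real n + e" v] mult_left_mono[OF dom[of "c * real n + e" v], of "\<bar>d n\<bar>"]
        by (simp add: abs_mult rl_kernel_nonneg)
    qed
  next
    show "summable (\<lambda>k. d k * rl_kernel (c * real k + e + 1) u)"
      using summable_frac_series(3)[OF d c _ u, of "e + 1"] e by (simp add: add.assoc)
  qed (use S in \<open>auto simp: interior_open\<close>)
  then show ?thesis by (simp add: frac_series_def[abs_def] add.assoc)
qed

text \<open>The substitution s = u t produces Euler's Beta integral, whose numerator Gamma(q)
  Gamma(r) cancels the normalisation of the two kernels.\<close>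

lemma rl_kernel_convolution:
  assumes "0 < r" "0 < q" "0 < u"
  shows "has_bochner_integral lborel
    (\<lambda>s. indicator {0<..<u} s *\<^sub>R (rl_kernel q (u - s) * rl_kernel r s)) (rl_kernel (q + r) u)"
proof -
  have "has_bochner_integral lborel
      (\<lambda>t. indicator {0..1} t *\<^sub>R (t powr (r - 1) * (1 - t) powr (q - 1))) (Beta r q)"
    using integrable_Beta[OF assms(1,2)] has_integral_Beta_real[OF assms(1,2)]
      set_borel_integral_eq_integral[OF integrable_Beta[OF assms(1,2)]]
    by (simp add: has_bochner_integral_iff set_integrable_def set_lebesgue_integral_def integral_unique)
  then have "has_bochner_integral lborel
      (\<lambda>t. u powr (q + r - 2) * rGamma q * rGamma r * (indicator {0..1} t *\<^sub>R (t powr (r - 1) * (1 - t) powr (q - 1))))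
      (u powr (q + r - 2) * rGamma q * rGamma r * Beta r q)"
    by (rule has_bochner_integral_mult_right)
  also have "(\<lambda>t. u powr (q + r - 2) * rGamma q * rGamma r *
        (indicator {0..1} t *\<^sub>R (t powr (r - 1) * (1 - t) powr (q - 1)))) =
      (\<lambda>t. indicator {0<..<u} (0 + u * t) *\<^sub>R (rl_kernel q (u - (0 + u * t)) * rl_kernel r (0 + u * t)))"
  proof
    fix t :: real
    \<comment> \<open>At t = 0 and t = 1 both sides are 0, since \<open>0 powr x\<close> is 0. The
      closed interval of the Beta integral and the open one of the convolution thus give the same
      function.\<close>
    consider "t \<notin> {0..1}" | "t = 0" | "t = 1" | "0 < t" "t < 1" by fastforce
    then show "u powr (q + r - 2) * rGamma q * rGamma r *
        (indicator {0..1} t *\<^sub>R (t powr (r - 1) * (1 - t) powr (q - 1))) =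
        indicator {0<..<u} (0 + u * t) *\<^sub>R (rl_kernel q (u - (0 + u * t)) * rl_kernel r (0 + u * t))"
    proof cases
      case 1
      then show ?thesis using assms by (auto simp: indicator_def zero_less_mult_iff)
    next
      case 4
      have 5: "u - u * t = u * (1 - t)" by (simp add: algebra_simps)
      have "u powr (q + r - 2) = u powr (q - 1) * u powr (r - 1)"
        by (simp add: powr_add[symmetric])
      with 4 assms show ?thesis
        by (simp add: rl_kernel_def 5 powr_mult)
    qed auto
  qed
  also have "u powr (q + r - 2) * rGamma q * rGamma r * Beta r q = rl_kernel (q + r) u /\<^sub>R \<bar>u\<bar>"
  proof -
    have "rGamma r * Gamma r = 1" "rGamma q * Gamma q = 1"
      unfolding rGamma_inverse_Gamma
      by (intro left_inverse less_imp_neq[THEN not_sym] Gamma_real_pos assms)+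
    moreover have "rGamma q * rGamma r * Beta r q =
        (rGamma q * Gamma q) * ((rGamma r * Gamma r) * rGamma (q + r))"
      unfolding Beta_altdef by (simp only: mult_ac add.commute)
    ultimately have "rGamma q * rGamma r * Beta r q = rGamma (q + r)"
      by (simp only: mult_1_left)
    moreover have "u powr (q + r - 2) = u powr (q + r - 1) / u"
      using assms powr_diff[of u "q + r - 1" 1] by simp
    ultimately show ?thesis
      using assms by (simp add: rl_kernel_def divide_inverse mult_ac)
  qed
  finally show ?thesis
    using assms by (subst lborel_has_bochner_integral_real_affine_iff[where c = u and t = 0]) auto
qed

text \<open>All products in the k-th Cauchy term have the same total index c k + e' + e, so this
  term integrates to a multiple of one kernel. As the kernels are nonnegative, the same computation
  with absolute values of the coefficients yields a summable majorant \<open>F'\<close>, which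
  permits integrating the series.\<close>

theorem frac_series_convolution:
  assumes d: "geom_bounded d" and d': "geom_bounded d'"
    and c: "0 < c" and e: "0 < e" and e': "0 < e'" and u: "0 < u"
  shows "has_bochner_integral lborel
    (\<lambda>s. indicator {0<..<u} s *\<^sub>R (frac_series c e' d' (u - s) * frac_series c e d s))
    (frac_series c (e' + e) (\<lambda>k. \<Sum>i\<le>k. d' i * d (k - i)) u)"
proof -
  define p where "p = (\<lambda>i j s. indicator {0<..<u} s *\<^sub>R (rl_kernel (c * real i + e') (u - s) * rl_kernel (c * real j + e) s))"
  define F where "F = (\<lambda>k s. \<Sum>i\<le>k. d' i * d (k - i) * p i (k - i) s)"
  define F' where "F' = (\<lambda>k s. \<Sum>i\<le>k. \<bar>d' i\<bar> * \<bar>d (k - i)\<bar> * p i (k - i) s)"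
  have p: "has_bochner_integral lborel (p i (k - i)) (rl_kernel (c * real k + (e' + e)) u)" if "i \<le> k" for i k
  proof -
    have "c * real i + e' + (c * real (k - i) + e) = c * real k + (e' + e)"
      using that by (simp add: of_nat_diff algebra_simps)
    moreover have "0 < c * real i + e'" "0 < c * real (k - i) + e"
      using c e e' by (simp_all add: add_nonneg_pos)
    ultimately show ?thesis unfolding p_def
      using rl_kernel_convolution[of "c * real (k - i) + e" "c * real i + e'" u] u by metis
  qed
  have p0: "0 \<le> p i j s" for i j s
    using c e e' by (simp add: p_def indicator_def rl_kernel_nonneg)
  have F: "has_bochner_integral lborel (F k)
      ((\<Sum>i\<le>k. d' i * d (k - i)) * rl_kernel (c * real k + (e' + e)) u)" for k
    unfolding F_def sum_distrib_right
    by (intro has_bochner_integral_sum has_bochner_integral_mult_right p) auto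
  have F': "has_bochner_integral lborel (F' k)
      ((\<Sum>i\<le>k. \<bar>d' i\<bar> * \<bar>d (k - i)\<bar>) * rl_kernel (c * real k + (e' + e)) u)" for k
    unfolding F'_def sum_distrib_right
    by (intro has_bochner_integral_sum has_bochner_integral_mult_right p) auto
  have FF': "norm (F k s) \<le> F' k s" for k s
    unfolding F_def F'_def real_norm_def
    by (intro order_trans[OF sum_abs] sum_mono) (simp add: abs_mult p0)
  have pw: "(\<lambda>k. F k s) sums (indicator {0<..<u} s *\<^sub>R (frac_series c e' d' (u - s) * frac_series c e d s))"
    and pw': "summable (\<lambda>k. norm (F k s))" for s
  proof -
    have "((\<lambda>k. F k s) sums (indicator {0<..<u} s *\<^sub>R (frac_series c e' d' (u - s) * frac_series c e d s)))
      \<and> summable (\<lambda>k. F' k s)"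
    proof (cases "s \<in> {0<..<u}")
      case True
      have A: "summable (\<lambda>k. norm (d' k * rl_kernel (c * real k + e') (u - s)))"
          "summable (\<lambda>k. norm (d k * rl_kernel (c * real k + e) s))"
        using True summable_frac_series(1)[OF d' c, of e' "u - s"] summable_frac_series(1)[OF d c, of e s] e e'
        by auto
      have B: "summable (\<lambda>k. norm (\<bar>d' k\<bar> * rl_kernel (c * real k + e') (u - s)))"
          "summable (\<lambda>k. norm (\<bar>d k\<bar> * rl_kernel (c * real k + e) s))"
        using A by (simp_all add: abs_mult)
      show ?thesis
        using Cauchy_product_sums[OF A] summable_Cauchy_product[OF B] True
        by (simp add: F_def F'_def p_def frac_series_def mult_ac)
    next
      case False
      then show ?thesis by (simp add: F_def F'_def p_def)
    qed
    then show "(\<lambda>k. F k s) sums (indicator {0<..<u} s *\<^sub>R (frac_series c e' d' (u - s) * frac_series c e d s))"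
      "summable (\<lambda>k. norm (F k s))"
      using FF' by (auto intro: summable_comparison_test_ev[of _ "\<lambda>k. F' k s"])
  qed
  have "summable (\<lambda>k. \<bar>\<Sum>i\<le>k. \<bar>d' i\<bar> * \<bar>d (k - i)\<bar>\<bar> * rl_kernel (c * real k + (e' + e)) u)"
    by (intro summable_frac_series geom_bounded_Cauchy_product geom_bounded_abs assms) (use e e' in auto)
  then have sF': "summable (\<lambda>k. \<integral>s. F' k s \<partial>lborel)"
    using F' by (simp add: has_bochner_integral_iff sum_nonneg)
  have sF: "summable (\<lambda>k. \<integral>s. norm (F k s) \<partial>lborel)"
  proof (rule summable_comparison_test_ev[OF _ sF'], intro always_eventually allI)
    fix k
    show "norm (\<integral>s. norm (F k s) \<partial>lborel) \<le> (\<integral>s. F' k s \<partial>lborel)"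
      using F[of k] F'[of k] FF' integral_mono[of lborel "\<lambda>s. norm (F k s)" "F' k"]
      by (simp add: has_bochner_integral_iff)
  qed
  have int: "integrable lborel (F k)" for k using F[of k] by (simp add: has_bochner_integral_iff)
  have eq: "(\<lambda>s. \<Sum>k. F k s) = (\<lambda>s. indicator {0<..<u} s *\<^sub>R (frac_series c e' d' (u - s) * frac_series c e d s))"
    using pw by (auto simp: sums_iff)
  show ?thesis
    using integrable_suminf[OF int _ sF] integral_suminf[OF int _ sF] pw' F
    unfolding eq by (simp add: has_bochner_integral_iff frac_series_def)
qed

section \<open>Double series and Caputo derivatives\<close>

lemma abs_summable_on_nat_iff:
  fixes f :: "nat \<Rightarrow> real"
  shows "(\<lambda>n. \<bar>f n\<bar>) summable_on UNIV \<longleftrightarrow> summable (\<lambda>n. \<bar>f n\<bar>)"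
  using summable_on_UNIV_nonneg_real_iff[of "\<lambda>n. \<bar>f n\<bar>"] by simp

lemma infsum_nat_eq_suminf:
  fixes f :: "nat \<Rightarrow> real"
  assumes "summable (\<lambda>n. \<bar>f n\<bar>)"
  shows "infsum f UNIV = suminf f"
  using norm_summable_imp_has_sum[of f "suminf f"] assms summable_rabs_cancel[OF assms]
  by (simp add: infsumI summable_sums)

text \<open>Absolute convergence in one order gives unconditional summability over the product.
  Fubini for unordered sums then supplies the other order together with its convergence.\<close>

lemma suminf_swap_abs:
  fixes f :: "nat \<Rightarrow> nat \<Rightarrow> real"
  assumes inner: "\<And>l. summable (\<lambda>n. \<bar>f n l\<bar>)"
    and outer: "summable (\<lambda>l. \<Sum>n. \<bar>f n l\<bar>)"
  shows "(\<Sum>n. \<Sum>l. f n l) = (\<Sum>l. \<Sum>n. f n l)"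
    and "summable (\<lambda>n. \<Sum>l. f n l)"
proof -
  have 1: "(\<lambda>x. norm ((\<lambda>(l, n). f n l) x)) summable_on UNIV \<times> UNIV"
    unfolding Infinite_Sum.abs_summable_on_Sigma_iff
    using inner outer
    by (auto simp: abs_summable_on_nat_iff infsum_nat_eq_suminf suminf_nonneg summable_on_UNIV_nonneg_real_iff)
  have 2: "(\<lambda>x. norm ((\<lambda>(n, l). f n l) x)) summable_on UNIV \<times> UNIV"
  proof -
    have "(\<lambda>x. norm ((\<lambda>(l, n). f n l) x)) summable_on prod.swap ` (UNIV \<times> UNIV)"
      using 1 by (simp add: product_swap)
    then show ?thesis
      by (subst (asm) summable_on_reindex) (auto simp: o_def case_prod_unfold)
  qed
  have 3: "summable (\<lambda>l. \<bar>f n l\<bar>)" for n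
    using 2[unfolded Infinite_Sum.abs_summable_on_Sigma_iff] by (auto simp: abs_summable_on_nat_iff)
  have 4: "summable (\<lambda>n. \<Sum>l. \<bar>f n l\<bar>)"
    using 2[unfolded Infinite_Sum.abs_summable_on_Sigma_iff]
    by (auto simp: infsum_nat_eq_suminf 3 suminf_nonneg summable_on_UNIV_nonneg_real_iff)
  have 5: "summable (\<lambda>n. \<bar>\<Sum>l. f n l\<bar>)"
    by (rule summable_comparison_test_ev[OF _ 4]) (auto intro!: always_eventually summable_rabs 3)
  then show "summable (\<lambda>n. \<Sum>l. f n l)" by (rule summable_rabs_cancel)
  have 6: "summable (\<lambda>l. \<bar>\<Sum>n. f n l\<bar>)"
    by (rule summable_comparison_test_ev[OF _ outer]) (auto intro!: always_eventually summable_rabs inner)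
  have "(\<Sum>n. \<Sum>l. f n l) = (\<Sum>\<^sub>\<infinity>n. \<Sum>\<^sub>\<infinity>l. f n l)"
    using 3 5 by (simp add: infsum_nat_eq_suminf)
  also have "\<dots> = (\<Sum>\<^sub>\<infinity>l. \<Sum>\<^sub>\<infinity>n. f n l)"
    by (rule infsum_swap_banach[OF Infinite_Sum.abs_summable_summable[OF 2]])
  also have "\<dots> = (\<Sum>l. \<Sum>n. f n l)"
    using inner 6 by (simp add: infsum_nat_eq_suminf)
  finally show "(\<Sum>n. \<Sum>l. f n l) = (\<Sum>l. \<Sum>n. f n l)" .
qed

section \<open>Linear operations, scaling and shifts of series\<close>

lemma frac_series_cong: "(\<And>k. d k = d' k) \<Longrightarrow> frac_series c e d u = frac_series c e d' u"
  by (simp add: frac_series_def)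

lemma frac_series_cmult:
  assumes "geom_bounded d" "0 < c" "0 \<le> e" "0 < u"
  shows "frac_series c e (\<lambda>k. q * d k) u = q * frac_series c e d u"
  unfolding frac_series_def
  by (subst suminf_mult[symmetric]) (use summable_frac_series[OF assms] in \<open>auto simp: mult.assoc\<close>)

lemma geom_bounded_add:
  assumes "geom_bounded d" "geom_bounded d'"
  shows "geom_bounded (\<lambda>k. d k + d' k)"
proof -
  obtain C R where d: "0 \<le> C" "0 \<le> R" "\<And>k. \<bar>d k\<bar> \<le> C * R ^ k"
    using assms(1) unfolding geom_bounded_def by blast
  obtain C' R' where d': "0 \<le> C'" "0 \<le> R'" "\<And>k. \<bar>d' k\<bar> \<le> C' * R' ^ k"
    using assms(2) unfolding geom_bounded_def by blast
  show ?thesis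
  proof (rule geom_boundedI)
    fix k
    have "C * R ^ k \<le> C * (max R R') ^ k" "C' * R' ^ k \<le> C' * (max R R') ^ k"
      using d d' by (auto intro!: mult_left_mono power_mono)
    then show "\<bar>d k + d' k\<bar> \<le> (C + C') * (max R R') ^ k"
      using d(3)[of k] d'(3)[of k] by (simp add: distrib_right)
  qed (use d d' in auto)
qed

lemma frac_series_add:
  assumes "geom_bounded d" "geom_bounded d'" "0 < c" "0 \<le> e" "0 < u"
  shows "frac_series c e (\<lambda>k. d k + d' k) u = frac_series c e d u + frac_series c e d' u"
  unfolding frac_series_def
  by (subst suminf_add) (use summable_frac_series(3) assms in \<open>auto simp: distrib_right\<close>)

lemma frac_series_sum:
  assumes "\<And>i. i \<in> I \<Longrightarrow> geom_bounded (d i)" "0 < c" "0 \<le> e" "0 < u"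
  shows "(\<Sum>i\<in>I. frac_series c e (d i) u) = frac_series c e (\<lambda>k. \<Sum>i\<in>I. d i k) u"
  unfolding frac_series_def sum_distrib_right
  by (rule suminf_sum[symmetric]) (use summable_frac_series(3) assms in auto)

lemma frac_series_abs_le:
  assumes "\<And>k. \<bar>d k\<bar> \<le> d' k" "geom_bounded d'" "0 < c" "0 \<le> e" "0 < u"
  shows "\<bar>frac_series c e d u\<bar> \<le> frac_series c e d' u"
proof -
  have s: "summable (\<lambda>k. d' k * rl_kernel (c * real k + e) u)"
    by (intro summable_frac_series assms)
  have le: "\<bar>d k * rl_kernel (c * real k + e) u\<bar> \<le> d' k * rl_kernel (c * real k + e) u" for k
    using assms by (auto simp: abs_mult rl_kernel_nonneg intro!: mult_right_mono)
  have s': "summable (\<lambda>k. \<bar>d k * rl_kernel (c * real k + e) u\<bar>)"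
    by (rule summable_comparison_test_ev[OF _ s]) (use le in auto)
  show ?thesis unfolding frac_series_def
    by (rule order_trans[OF summable_rabs[OF s'] suminf_le[OF le s' s]])
qed

text \<open>The kernels are homogeneous, so the series is u^(e-1) times a power series in u^c with
  Gamma denominators. This is the form in which Mittag-Leffler functions enter.\<close>

lemma frac_series_scale:
  assumes "0 < u" "geom_bounded (\<lambda>k. d k * (u powr c) ^ k)" "0 < c" "0 \<le> e"
  shows "frac_series c e d u = u powr (e - 1) * frac_series c e (\<lambda>k. d k * (u powr c) ^ k) 1"
proof -
  have "u powr (c * real k + e - 1) = u powr (e - 1) * (u powr c) ^ k" for k
    using assms(1) by (simp add: powr_power powr_add[symmetric] algebra_simps)
  then show ?thesis
    unfolding frac_series_def
    by (subst suminf_mult[symmetric], use summable_frac_series(3)[of _ c e 1] assms in simp)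
      (simp add: rl_kernel_def mult_ac)
qed

lemma frac_series_shift:
  assumes "geom_bounded d" "0 < c" "0 \<le> e" "0 < u" "\<And>m. m < n \<Longrightarrow> d m = 0"
  shows "frac_series c (c * real n + e) (\<lambda>k. d (k + n)) u = frac_series c e d u"
  unfolding frac_series_def
  by (subst suminf_split_initial_segment[OF summable_frac_series(3)[OF assms(1-4)], of n])
    (simp add: assms(5) algebra_simps)

text \<open>The leading kernel has index 0 and hence vanishes. This is where a derivative loses the
  coefficient \<open>d 0\<close>.\<close>

lemma frac_series_0:
  assumes "geom_bounded d" "0 < c" "0 < u"
  shows "frac_series c 0 d u = frac_series c c (\<lambda>k. d (Suc k)) u"
  using suminf_split_head[OF summable_frac_series(3)[OF assms(1,2) order_refl assms(3)]]
  by (simp add: frac_series_def rl_kernel_def algebra_simps)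

section \<open>Series in two variables\<close>

definition geom_bounded2 :: "(nat \<Rightarrow> nat \<Rightarrow> real) \<Rightarrow> bool" where
  "geom_bounded2 K \<longleftrightarrow> (\<exists>C\<ge>0. \<exists>R\<ge>0. \<exists>S\<ge>0. \<forall>m l. \<bar>K m l\<bar> \<le> C * R ^ m * S ^ l)"

lemma geom_bounded2I:
  "(\<And>m l. \<bar>K m l\<bar> \<le> C * R ^ m * S ^ l) \<Longrightarrow> 0 \<le> C \<Longrightarrow> 0 \<le> R \<Longrightarrow> 0 \<le> S \<Longrightarrow> geom_bounded2 K"
  unfolding geom_bounded2_def by blast

lemma geom_bounded2_flip: "geom_bounded2 K \<Longrightarrow> geom_bounded2 (\<lambda>l m. K m l)"
  unfolding geom_bounded2_def by (metis (no_types, lifting) mult.assoc mult.commute)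

lemma geom_bounded2_row:
  assumes "geom_bounded2 K"
  shows "geom_bounded (K m)"
proof -
  obtain C R S where K: "0 \<le> C" "0 \<le> R" "0 \<le> S" "\<And>m l. \<bar>K m l\<bar> \<le> C * R ^ m * S ^ l"
    using assms unfolding geom_bounded2_def by blast
  show ?thesis by (rule geom_boundedI[of _ "C * R ^ m" S]) (use K in auto)
qed

lemma geom_bounded2_Suc:
  assumes "geom_bounded2 K"
  shows "geom_bounded2 (\<lambda>m l. K m (Suc l))"
proof -
  obtain C R S where K: "0 \<le> C" "0 \<le> R" "0 \<le> S" "\<And>m l. \<bar>K m l\<bar> \<le> C * R ^ m * S ^ l"
    using assms unfolding geom_bounded2_def by blast
  show ?thesis
  proof (rule geom_bounded2I)
    show "\<bar>K m (Suc l)\<bar> \<le> (C * S) * R ^ m * S ^ l" for m l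
      using K(4)[of m "Suc l"] by (simp add: mult_ac)
  qed (use K in auto)
qed

text \<open>The factor R^m can be taken out of the majorant, so a partially summed series is again
  an admissible coefficient sequence for the other variable, and the results in one variable can be
  iterated.\<close>

lemma geom_bounded_frac_series:
  assumes "geom_bounded2 K" "0 < c" "0 \<le> e" "0 < u"
  shows "geom_bounded (\<lambda>m. frac_series c e (K m) u)"
proof -
  obtain C R S where K: "0 \<le> C" "0 \<le> R" "0 \<le> S" "\<And>m l. \<bar>K m l\<bar> \<le> C * R ^ m * S ^ l"
    using assms unfolding geom_bounded2_def by blast
  have S: "geom_bounded (\<lambda>l. S ^ l)" by (rule geom_boundedI[of _ 1 S]) (use K in auto)
  show ?thesis
  proof (rule geom_boundedI)
    fix m
    have "\<bar>frac_series c e (K m) u\<bar> \<le> frac_series c e (\<lambda>l. C * R ^ m * S ^ l) u"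
      by (rule frac_series_abs_le)
        (use K assms in \<open>auto intro!: geom_boundedI[of _ "C * R ^ m" S]\<close>)
    also have "\<dots> = C * frac_series c e (\<lambda>l. S ^ l) u * R ^ m"
      using S assms by (simp add: frac_series_cmult)
    finally show "\<bar>frac_series c e (K m) u\<bar> \<le> C * frac_series c e (\<lambda>l. S ^ l) u * R ^ m" .
    show "0 \<le> C * frac_series c e (\<lambda>l. S ^ l) u"
      using frac_series_abs_le[of "\<lambda>l. S ^ l" "\<lambda>l. S ^ l" c e u] S K assms
      by (auto intro!: mult_nonneg_nonneg)
  qed (use K in auto)
qed

text \<open>A Caputo derivative in time wants the space series as coefficients, one in space wants
  the time series; this passes between the two forms.\<close>

lemma frac_series_swap:
  assumes K: "geom_bounded2 K" and a: "0 < a" "0 \<le> e" "0 < t" and b: "0 < b" "0 \<le> e'" "0 < y"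
  shows "frac_series a e (\<lambda>m. frac_series b e' (K m) y) t =
    frac_series b e' (\<lambda>l. frac_series a e (\<lambda>m. K m l) t) y"
proof -
  define F where "F = (\<lambda>m l. K m l * rl_kernel (b * real l + e') y * rl_kernel (a * real m + e) t)"
  have Kabs: "geom_bounded2 (\<lambda>m l. \<bar>K m l\<bar>)" using K unfolding geom_bounded2_def by simp
  have Fabs: "(\<lambda>m. \<bar>F m l\<bar>) = (\<lambda>m. (\<bar>K m l\<bar> * rl_kernel (a * real m + e) t) * rl_kernel (b * real l + e') y)" for l
    using a b by (auto simp: F_def abs_mult rl_kernel_nonneg)
  have row: "summable (\<lambda>m. \<bar>K m l\<bar> * rl_kernel (a * real m + e) t)" for l
    using summable_frac_series(2)[OF geom_bounded2_row[OF geom_bounded2_flip[OF K], of l] a] .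
  have sw: "(\<Sum>m. \<Sum>l. F m l) = (\<Sum>l. \<Sum>m. F m l)"
  proof (rule suminf_swap_abs)
    show "summable (\<lambda>m. \<bar>F m l\<bar>)" for l
      unfolding Fabs by (rule summable_mult2[OF row])
    show "summable (\<lambda>l. \<Sum>m. \<bar>F m l\<bar>)"
      unfolding Fabs suminf_mult2[OF row, symmetric]
      using summable_frac_series(3)[OF geom_bounded_frac_series[OF geom_bounded2_flip[OF Kabs] a] b]
      by (simp add: frac_series_def)
  qed
  have "frac_series a e (\<lambda>m. frac_series b e' (K m) y) t = (\<Sum>m. \<Sum>l. F m l)"
    unfolding F_def frac_series_def
    by (intro suminf_cong suminf_mult2 summable_frac_series(3) geom_bounded2_row K b)
  also have "\<dots> = frac_series b e' (\<lambda>l. frac_series a e (\<lambda>m. K m l) t) y"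
    unfolding sw
    unfolding F_def frac_series_def
    by (subst suminf_mult2)
      (use summable_frac_series(3)[OF geom_bounded2_row[OF geom_bounded2_flip[OF K]] a] in \<open>auto simp: mult_ac\<close>)
  finally show ?thesis .
qed

text \<open>The convolution with the one-term series \<open>rl_kernel\<close> is the Riemann-Liouville integral.\<close>

lemma frac_series_rl_integral:
  assumes d: "geom_bounded d" and c: "0 < c" and e: "0 < e" and r: "0 < r" and u: "0 < u"
  shows "has_bochner_integral lborel
    (\<lambda>s. indicator {0<..<u} s *\<^sub>R (frac_series c e d s * (u - s) powr (r - 1)))
    (Gamma r * frac_series c (r + e) d u)"
proof -
  \<comment> \<open>The unit of the Cauchy product, so that the convolution leaves the coefficients
    \<open>d\<close> unchanged.\<close>
  define d' where "d' = (\<lambda>k::nat. if k = 0 then 1 else 0 :: real)"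
  have d': "geom_bounded d'" by (rule geom_boundedI[of _ 1 1]) (auto simp: d'_def)
  have k: "frac_series c r d' v = rl_kernel r v" for v
    unfolding frac_series_def by (subst suminf_finite[of "{0}"]) (auto simp: d'_def)
  have s: "(\<lambda>k. \<Sum>i\<le>k. d' i * d (k - i)) = d"
    by (auto simp: d'_def if_distrib[of "\<lambda>x. x * _"] cong: if_cong)
  have g: "Gamma r * rGamma r = 1"
    using Gamma_real_pos[OF r] by (simp add: rGamma_inverse_Gamma)
  have *: "(\<lambda>s. Gamma r * (indicator {0<..<u} s *\<^sub>R (frac_series c r d' (u - s) * frac_series c e d s))) =
    (\<lambda>s. indicator {0<..<u} s *\<^sub>R (frac_series c e d s * (u - s) powr (r - 1)))"
  proof
    fix s
    have "Gamma r * (rl_kernel r (u - s) * frac_series c e d s) =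
      (Gamma r * rGamma r) * (frac_series c e d s * (u - s) powr (r - 1))"
      by (simp add: rl_kernel_def mult_ac)
    then show "Gamma r * (indicator {0<..<u} s *\<^sub>R (frac_series c r d' (u - s) * frac_series c e d s)) =
      indicator {0<..<u} s *\<^sub>R (frac_series c e d s * (u - s) powr (r - 1))"
      by (simp add: k g mult.left_commute)
  qed
  show ?thesis
    using has_bochner_integral_mult_right[OF frac_series_convolution[OF d d' c e r u], of "Gamma r"]
    unfolding s * by simp
qed

text \<open>Differentiation removes the constant term, after which the series starts at index
  \<open>a\<close>; the fractional integral of order 1 - a lifts this back to 1. For a = 1 the
  derivative alone suffices. Derivatives are local, so \<open>g\<close> has to agree with the series
  on the open half-line only.\<close>

lemma caputo_frac_series:
  assumes d: "geom_bounded d" and a: "0 < a" "a \<le> 1" and t: "0 < t"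
    and g: "\<And>s. 0 < s \<Longrightarrow> g s = frac_series a 1 d s"
  shows "caputo_exists a g t" and "caputo a g t = frac_series a 1 (\<lambda>k. d (Suc k)) t"
proof -
  have D: "(g has_real_derivative frac_series a a (\<lambda>k. d (Suc k)) s) (at s)" if "0 < s" for s
  proof -
    have "(frac_series a (0 + 1) d has_real_derivative frac_series a 0 d s) (at s)"
      by (rule frac_series_has_derivative) (use d a that in auto)
    then have "(frac_series a 1 d has_real_derivative frac_series a a (\<lambda>k. d (Suc k)) s) (at s)"
      using frac_series_0[OF d a(1) that] by simp
    then show ?thesis
      by (rule has_field_derivative_transform_within_open[of _ _ _ "{0<..}"]) (use g that in auto)
  qed
  have D': "g field_differentiable at s" "deriv g s = frac_series a a (\<lambda>k. d (Suc k)) s" if "0 < s" for s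
    using D[OF that] by (auto simp: field_differentiable_def DERIV_imp_deriv)
  have "caputo_exists a g t \<and> caputo a g t = frac_series a 1 (\<lambda>k. d (Suc k)) t"
  proof (cases "a = 1")
    case True
    then show ?thesis using D'[OF t] by (simp add: caputo_exists_def caputo_def)
  next
    case False
    with a have a1: "0 < 1 - a" by simp
    have *: "(\<lambda>s. indicator {0<..<t} s *\<^sub>R (deriv g s / (t - s) powr a)) =
        (\<lambda>s. indicator {0<..<t} s *\<^sub>R (frac_series a a (\<lambda>k. d (Suc k)) s * (t - s) powr (1 - a - 1)))"
      by (auto simp: fun_eq_iff indicator_def D' powr_minus divide_inverse)
    have "has_bochner_integral lborel (\<lambda>s. indicator {0<..<t} s *\<^sub>R (deriv g s / (t - s) powr a))
      (Gamma (1 - a) * frac_series a 1 (\<lambda>k. d (Suc k)) t)"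
      unfolding * using frac_series_rl_integral[OF geom_bounded_Suc[OF d] a(1) a(1) a1 t] by simp
    then show ?thesis
      using False D' Gamma_real_pos[OF a1]
      by (auto simp: caputo_exists_def caputo_def set_integrable_def set_lebesgue_integral_def
          has_bochner_integral_iff)
  qed
  then show "caputo_exists a g t" "caputo a g t = frac_series a 1 (\<lambda>k. d (Suc k)) t" by auto
qed

text \<open>The integral of order 1 - b comes first and raises the leading index from
  \<open>b\<close> to 1; the singular term becomes a constant and the derivative removes it. For b <
  1 a nonzero \<open>g 0\<close> would leave an extra multiple of y^(-b).\<close>

lemma caputo_ext_frac_series:
  assumes d: "geom_bounded d" and b: "0 < b" "b \<le> 1" and y: "0 < y"
    and g: "\<And>s. 0 < s \<Longrightarrow> g s = frac_series b b d s" and g0: "g 0 = 0"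
  shows "caputo_ext_exists b g y" and "caputo_ext b g y = frac_series b b (\<lambda>k. d (Suc k)) y"
proof -
  \<comment> \<open>\<open>h\<close> will be \<open>g\<close> itself if b = 1 and its fractional
    integral otherwise, so both cases share this derivative.\<close>
  have D: "(h has_real_derivative frac_series b b (\<lambda>k. d (Suc k)) y) (at y)"
    if "\<And>s. 0 < s \<Longrightarrow> h s = frac_series b 1 d s" for h
  proof -
    have "(frac_series b (0 + 1) d has_real_derivative frac_series b 0 d y) (at y)"
      by (rule frac_series_has_derivative) (use d b y in auto)
    then have "(frac_series b 1 d has_real_derivative frac_series b b (\<lambda>k. d (Suc k)) y) (at y)"
      using frac_series_0[OF d b(1) y] by simp
    then show ?thesis
      by (rule has_field_derivative_transform_within_open[of _ _ _ "{0<..}"]) (use that y in auto)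
  qed
  have "caputo_ext_exists b g y \<and> caputo_ext b g y = frac_series b b (\<lambda>k. d (Suc k)) y"
  proof (cases "b = 1")
    case True
    then show ?thesis using D[of g] g
      by (auto simp: caputo_ext_exists_def caputo_ext_def field_differentiable_def DERIV_imp_deriv)
  next
    case False
    with b have b1: "0 < 1 - b" by simp
    have I: "has_bochner_integral lborel (\<lambda>s. indicator {0<..<u} s *\<^sub>R ((g s - g 0) / (u - s) powr b))
      (Gamma (1 - b) * frac_series b 1 d u)" if "0 < u" for u
    proof -
      have *: "(\<lambda>s. indicator {0<..<u} s *\<^sub>R ((g s - g 0) / (u - s) powr b)) =
          (\<lambda>s. indicator {0<..<u} s *\<^sub>R (frac_series b b d s * (u - s) powr (1 - b - 1)))"
        by (auto simp: fun_eq_iff indicator_def g g0 powr_minus divide_inverse)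
      show ?thesis
        unfolding * using frac_series_rl_integral[OF d b(1) b(1) b1 that] by simp
    qed
    have "((\<lambda>u. 1 / Gamma (1 - b) * (LBINT s:{0<..<u}. (g s - g 0) / (u - s) powr b))
        has_real_derivative frac_series b b (\<lambda>k. d (Suc k)) y) (at y)"
      by (rule D) (use I Gamma_real_pos[OF b1] in \<open>auto simp: set_lebesgue_integral_def has_bochner_integral_iff\<close>)
    then show ?thesis
      using False I
      by (auto simp: caputo_ext_exists_def caputo_ext_def set_integrable_def has_bochner_integral_iff
          field_differentiable_def DERIV_imp_deriv)
  qed
  then show "caputo_ext_exists b g y" "caputo_ext b g y = frac_series b b (\<lambda>k. d (Suc k)) y" by auto
qed

section \<open>The Mittag-Leffler expansions\<close>

text \<open>At x = lam t1^a t2 this is the probability that the field with indices \<open>a\<close>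
  and 1 has the value n.\<close>

definition poisson_weight :: "real \<Rightarrow> real \<Rightarrow> nat \<Rightarrow> real" where
  "poisson_weight a x n = x ^ n * mittag_leffler3 a (a * real n + 1) (real n + 1) (- x)"

text \<open>For n >= 1 this is the n-fold convolution power of the jump density.\<close>

definition jump_sum_density :: "real \<Rightarrow> real \<Rightarrow> nat \<Rightarrow> real \<Rightarrow> real" where
  "jump_sum_density \<sigma> b n y =
     (if 0 < y then 1 / y * (\<sigma> * y powr b) ^ n * mittag_leffler3 b (b * real n) (real n) (- (\<sigma> * y powr b)) else 0)"

section \<open>Binomial series and three-parameter Mittag-Leffler functions\<close>

lemma choose_le_power2: "real (n choose k) \<le> 2 ^ n"
proof (cases "k \<le> n")
  case True
  then have "n choose k \<le> (\<Sum>i\<le>n. n choose i)"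
    by (intro member_le_sum) auto
  also have "\<dots> = 2 ^ n" by (rule choose_row_sum)
  finally show ?thesis by (metis of_nat_le_iff of_nat_numeral of_nat_power)
qed (simp add: binomial_eq_0)

lemma geom_bounded_choose: "geom_bounded (\<lambda>m. (-1) ^ (m - n) * real (m choose n) * w ^ m)"
proof (rule geom_boundedI)
  fix m
  have "\<bar>(-1) ^ (m - n) * real (m choose n) * w ^ m\<bar> = real (m choose n) * \<bar>w\<bar> ^ m"
    by (simp add: abs_mult power_abs)
  also have "\<dots> \<le> 2 ^ m * \<bar>w\<bar> ^ m" by (intro mult_right_mono choose_le_power2) auto
  finally show "\<bar>(-1) ^ (m - n) * real (m choose n) * w ^ m\<bar> \<le> 1 * (2 * \<bar>w\<bar>) ^ m"
    by (simp add: power_mult_distrib)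
qed auto

lemma pochhammer_div_fact: "pochhammer (real n + 1) k / fact k = real ((k + n) choose n)"
proof -
  have "real ((k + n) choose n) = real ((n + k) choose k)"
    by (metis add.commute binomial_symmetric diff_add_inverse le_add1)
  also have "\<dots> = real (n + k) gchoose k" by (rule binomial_gbinomial)
  also have "\<dots> = pochhammer (real n + 1) k / fact k"
    by (simp add: gbinomial_pochhammer')
  finally show ?thesis by simp
qed

lemma geom_bounded_choose_shift: "geom_bounded (\<lambda>k. real ((k + n) choose n) * w ^ k)"
proof (rule geom_boundedI)
  fix k
  have "\<bar>real ((k + n) choose n) * w ^ k\<bar> = real ((k + n) choose n) * \<bar>w\<bar> ^ k"
    by (simp add: abs_mult power_abs)
  also have "\<dots> \<le> 2 ^ (k + n) * \<bar>w\<bar> ^ k" by (intro mult_right_mono choose_le_power2) auto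
  finally show "\<bar>real ((k + n) choose n) * w ^ k\<bar> \<le> 2 ^ n * (2 * \<bar>w\<bar>) ^ k"
    by (simp add: power_mult_distrib power_add mult_ac)
qed auto

lemma mittag_leffler3_frac_series:
  "mittag_leffler3 a b (real n + 1) x = frac_series a b (\<lambda>k. real ((k + n) choose n) * x ^ k) 1"
  unfolding mittag_leffler3_def frac_series_def pochhammer_div_fact[symmetric]
  by (simp add: rl_kernel_def rGamma_inverse_Gamma field_simps)

text \<open>The coefficients with m < n vanish, which makes the truncated \<open>m - n\<close>
  harmless. Shifting by n extracts (w u^c)^n and leaves the binomial series of the three-parameter
  function. The case e = 1 gives the weights, the case e = c the densities of sums of jumps.\<close>

lemma frac_series_choose:
  assumes "0 < c" "0 \<le> e" "0 < u"
  shows "frac_series c e (\<lambda>m. (-1) ^ (m - n) * real (m choose n) * w ^ m) u =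
    u powr (e - 1) * (w * u powr c) ^ n * mittag_leffler3 c (c * real n + e) (real n + 1) (- (w * u powr c))"
proof -
  define z where "z = - (w * u powr c)"
  have 1: "(-1) ^ (k + n - n) * real ((k + n) choose n) * w ^ (k + n) = w ^ n * (real ((k + n) choose n) * (- w) ^ k)" for k
    by (simp add: power_add power_mult_distrib[symmetric] mult_ac)
  have 2: "w ^ n * (real ((k + n) choose n) * (- w) ^ k) * (u powr c) ^ k = w ^ n * (real ((k + n) choose n) * z ^ k)" for k
    by (simp add: z_def power_mult_distrib[symmetric] mult.assoc)
  have "frac_series c e (\<lambda>m. (-1) ^ (m - n) * real (m choose n) * w ^ m) u =
      frac_series c (c * real n + e) (\<lambda>k. w ^ n * (real ((k + n) choose n) * (- w) ^ k)) u"
    by (subst frac_series_shift[symmetric, where n = n])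
      (use assms geom_bounded_choose 1 in \<open>auto intro: frac_series_cong\<close>)
  also have "\<dots> = u powr (c * real n + e - 1) *
      frac_series c (c * real n + e) (\<lambda>k. w ^ n * (real ((k + n) choose n) * z ^ k)) 1"
    by (subst frac_series_scale) (use assms in \<open>simp_all only: 2 geom_bounded_cmult geom_bounded_choose_shift, auto\<close>)
  also have "\<dots> = u powr (c * real n + e - 1) * (w ^ n * mittag_leffler3 c (c * real n + e) (real n + 1) z)"
    unfolding mittag_leffler3_frac_series
    by (subst frac_series_cmult) (use assms geom_bounded_choose_shift in simp_all)
  also have "u powr (c * real n + e - 1) = u powr (e - 1) * (u powr c) ^ n"
    using assms by (simp add: powr_power powr_add[symmetric] algebra_simps)
  finally show ?thesis by (simp add: z_def power_mult_distrib mult_ac)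
qed

lemma poisson_weight_frac_series:
  assumes "0 < a" "0 < t"
  shows "poisson_weight a (w * t powr a) n = frac_series a 1 (\<lambda>m. (-1) ^ (m - n) * real (m choose n) * w ^ m) t"
  using assms by (simp add: frac_series_choose poisson_weight_def)

lemma jump_sum_density_frac_series:
  assumes "0 < b" "0 < y"
  shows "jump_sum_density \<sigma> b (Suc n) y =
    frac_series b b (\<lambda>l. \<sigma> * ((-1) ^ (l - n) * real (l choose n) * \<sigma> ^ l)) y"
proof -
  have 1: "1 / y * (\<sigma> * y powr b) ^ Suc n = \<sigma> * (y powr (b - 1) * (\<sigma> * y powr b) ^ n)"
    using assms by (simp add: powr_diff)
  have 2: "b * real (Suc n) = b * real n + b" "real (Suc n) = real n + 1"
    by (simp_all add: algebra_simps)
  have 3: "frac_series b b (\<lambda>l. \<sigma> * ((-1) ^ (l - n) * real (l choose n) * \<sigma> ^ l)) y =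
      \<sigma> * frac_series b b (\<lambda>l. (-1) ^ (l - n) * real (l choose n) * \<sigma> ^ l) y"
    using assms by (intro frac_series_cmult geom_bounded_choose) auto
  have 4: "frac_series b b (\<lambda>l. (-1) ^ (l - n) * real (l choose n) * \<sigma> ^ l) y =
      y powr (b - 1) * (\<sigma> * y powr b) ^ n * mittag_leffler3 b (b * real n + b) (real n + 1) (- (\<sigma> * y powr b))"
    using assms by (intro frac_series_choose) auto
  have "jump_sum_density \<sigma> b (Suc n) y =
      1 / y * (\<sigma> * y powr b) ^ Suc n * mittag_leffler3 b (b * real n + b) (real n + 1) (- (\<sigma> * y powr b))"
    unfolding jump_sum_density_def 2(1) 2(2) using assms by (simp only: if_True distrib_left mult_1_right)
  then show ?thesis
    unfolding 1 3 4 by (simp only: mult.assoc)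
qed

lemma falling_eq: "m \<le> k \<Longrightarrow> falling k m = fact k / fact (k - m)"
proof (induction m)
  case 0
  then show ?case by (simp add: falling_def)
next
  case (Suc m)
  then have "k - m = Suc (k - Suc m)" by simp
  then have f: "(fact (k - m) :: real) = (real k - real m) * fact (k - Suc m)"
    using Suc.prems by (simp add: of_nat_diff)
  have "falling k (Suc m) = falling k m * (real k - real m)" by (simp add: falling_def)
  also have "\<dots> = fact k / fact (k - m) * (real k - real m)" using Suc by simp
  also have "\<dots> = fact k / fact (k - Suc m)"
    unfolding f using Suc.prems by simp
  finally show ?case .
qed

text \<open>With k = n + j the two falling factorials multiply to (k!/n!) (k!/j!). As the second
  index is 1, one Gamma factor is k!, and a single binomial coefficient remains.\<close>

lemma fractional_poisson_prob_eq:
  assumes "0 < a" "0 \<le> t2"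
  shows "fractional_poisson_prob lam a 1 n t1 t2 = poisson_weight a (lam * t1 powr a * t2) n"
proof -
  define x where "x = lam * t1 powr a * t2"
  have x: "lam * t1 powr a * t2 powr 1 = x"
    using assms by (simp add: x_def)
  have summand: "(-1) ^ (n + j - n) * falling (n + j) (n + j - n) * falling (n + j) n * x ^ (n + j)
      / (Gamma (real (n + j) * a + 1) * Gamma (real (n + j) * 1 + 1))
    = x ^ n * (real ((j + n) choose n) * (- x) ^ j * rl_kernel (a * real j + (a * real n + 1)) 1)" for j
  proof -
    have G: "Gamma (real (n + j) * 1 + 1) = fact (n + j)"
      using Gamma_fact[of "n + j", where 'a = real] by (simp add: add.commute)
    have B: "real ((j + n) choose n) = fact (n + j) / (fact n * fact j)"
      using binomial_fact[of n "j + n", where 'a = real] by (simp add: add.commute)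
    have "(- x) ^ j = (-1) ^ j * x ^ j" by (simp add: power_mult_distrib[symmetric])
    then show ?thesis
      unfolding G B
      by (simp add: falling_eq rl_kernel_def rGamma_inverse_Gamma power_add algebra_simps divide_inverse)
  qed
  have "fractional_poisson_prob lam a 1 n t1 t2 =
      (\<Sum>j. x ^ n * (real ((j + n) choose n) * (- x) ^ j * rl_kernel (a * real j + (a * real n + 1)) 1))"
    unfolding fractional_poisson_prob_def Let_def x summand ..
  also have "\<dots> = poisson_weight a x n"
    unfolding poisson_weight_def mittag_leffler3_frac_series frac_series_def
    by (rule suminf_mult) (use summable_frac_series(3)[OF geom_bounded_choose_shift assms(1), of "a * real n + 1" 1] assms in auto)
  finally show ?thesis by (simp add: x_def)
qed

lemma compound_density_term_eq:
  assumes "0 < y"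
  shows "compound_density_term lam \<sigma> a b y t1 t2 n =
    poisson_weight a (lam * t1 powr a * t2) n * (y * jump_sum_density \<sigma> b n y)"
  using assms
  by (simp add: compound_density_term_def poisson_weight_def jump_sum_density_def power_mult_distrib mult_ac)

text \<open>The coefficient of the kernel of index a m + 1 in time times the kernel of index b l + b
  in space. It is 0 for m = 0, in accordance with a density that vanishes at t1 = 0.\<close>

definition compound_coeff :: "real \<Rightarrow> real \<Rightarrow> nat \<Rightarrow> nat \<Rightarrow> real" where
  "compound_coeff w \<sigma> m l = (-1) ^ (m + l + 1) * real ((m + l) choose (l + 1)) * w ^ m * \<sigma> ^ (l + 1)"

lemma geom_bounded2_compound_coeff: "geom_bounded2 (compound_coeff w \<sigma>)"
proof (rule geom_bounded2I)
  fix m l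
  have "\<bar>compound_coeff w \<sigma> m l\<bar> = real ((m + l) choose (l + 1)) * (\<bar>w\<bar> ^ m * \<bar>\<sigma>\<bar> ^ (l + 1))"
    by (simp add: compound_coeff_def abs_mult power_abs)
  also have "\<dots> \<le> 2 ^ (m + l) * (\<bar>w\<bar> ^ m * \<bar>\<sigma>\<bar> ^ (l + 1))"
    by (intro mult_right_mono choose_le_power2) auto
  finally show "\<bar>compound_coeff w \<sigma> m l\<bar> \<le> \<bar>\<sigma>\<bar> * (2 * \<bar>w\<bar>) ^ m * (2 * \<bar>\<sigma>\<bar>) ^ l"
    by (simp add: power_add power_mult_distrib mult_ac)
qed auto

text \<open>All three terms carry w^(m+1) \<sigma>^(l+2). The last one has the opposite sign of the
  other two, so splitting its binomial as X + Y cancels Y.\<close>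

lemma compound_coeff_recurrence:
  "\<sigma> * compound_coeff w \<sigma> (Suc m) l =
    - (w * compound_coeff w \<sigma> m (Suc l) + compound_coeff w \<sigma> (Suc m) (Suc l))"
proof -
  define X Y where "X = real ((m + Suc l) choose Suc l)" and "Y = real ((m + Suc l) choose Suc (Suc l))"
  have X: "real ((Suc m + l) choose (l + 1)) = X" and Y: "real ((m + Suc l) choose (Suc l + 1)) = Y"
    and XY: "real ((Suc m + Suc l) choose (Suc l + 1)) = X + Y"
    by (simp_all add: X_def Y_def)
  show ?thesis
    unfolding compound_coeff_def X Y XY by (simp add: algebra_simps)
qed

text \<open>Where the binomials are nonzero, the two exponents add up to m + l + 1 modulo 2 and the
  sign factors out. The reflected binomials form Vandermonde's sum, whose extra term k = 0 contains
  l choose (l + 1) = 0.\<close>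

lemma alternating_vandermonde:
  "(\<Sum>n\<le>l. (-1) ^ (l - n) * (-1) ^ (m - Suc n) * (real (l choose n) * real (m choose Suc n))) =
    (-1) ^ (m + l + 1) * real ((m + l) choose (l + 1))"
proof -
  have "(\<Sum>n\<le>l. (-1) ^ (l - n) * (-1) ^ (m - Suc n) * (real (l choose n) * real (m choose Suc n))) =
      (\<Sum>n\<le>l. (-1) ^ (m + l + 1) * real ((m choose Suc n) * (l choose (l - n))))"
  proof (rule sum.cong[OF refl])
    fix n assume n: "n \<in> {..l}"
    show "(-1) ^ (l - n) * (-1) ^ (m - Suc n) * (real (l choose n) * real (m choose Suc n)) =
      (-1) ^ (m + l + 1) * real ((m choose Suc n) * (l choose (l - n)))"
    proof (cases "Suc n \<le> m")
      case True
      have "m + l + 1 = (l - n) + (m - Suc n) + 2 * (n + 1)" using n True by simp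
      then have "(-1 :: real) ^ (m + l + 1) = (-1) ^ (l - n) * (-1) ^ (m - Suc n)"
        by (simp only: power_add power_mult) simp
      with n show ?thesis by (simp add: binomial_symmetric[of n l])
    qed (simp add: binomial_eq_0)
  qed
  also have "\<dots> = (-1) ^ (m + l + 1) * real (\<Sum>n\<le>l. (m choose Suc n) * (l choose (l - n)))"
    by (simp add: sum_distrib_left)
  also have "(\<Sum>n\<le>l. (m choose Suc n) * (l choose (l - n))) = (\<Sum>k\<le>Suc l. (m choose k) * (l choose (Suc l - k)))"
    by (subst sum.atMost_Suc_shift) (simp add: binomial_eq_0)
  also have "\<dots> = (m + l) choose Suc l" by (rule vandermonde)
  finally show ?thesis by simp
qed

text \<open>Expanding both Mittag-Leffler factors and summing over \<open>n\<close> first leaves a double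
  series whose coefficients \<open>compound_coeff\<close> come from Vandermonde's identity.\<close>

lemma compound_series:
  assumes a: "0 < a" and b: "0 < b" and t: "0 < t" and y: "0 < y"
  shows "summable (\<lambda>n. poisson_weight a (w * t powr a) (Suc n) * jump_sum_density \<sigma> b (Suc n) y)"
    and "(\<Sum>n. poisson_weight a (w * t powr a) (Suc n) * jump_sum_density \<sigma> b (Suc n) y) =
      frac_series b b (\<lambda>l. frac_series a 1 (\<lambda>m. compound_coeff w \<sigma> m l) t) y"
proof -
  define P where "P n = poisson_weight a (w * t powr a) (Suc n)" for n
  define g where "g l n = \<sigma> * ((-1) ^ (l - n) * real (l choose n) * \<sigma> ^ l)" for l n
  define F where "F n l = P n * (g l n * rl_kernel (b * real l + b) y)" for n l
  have P: "P n = frac_series a 1 (\<lambda>m. (-1) ^ (m - Suc n) * real (m choose Suc n) * w ^ m) t" for n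
    unfolding P_def by (rule poisson_weight_frac_series[OF a t])
  have gb: "geom_bounded (\<lambda>l. g l n)" for n
    unfolding g_def by (intro geom_bounded_cmult geom_bounded_choose)
  \<comment> \<open>One bound for all weights. Here \<open>w\<close> is an arbitrary real number, so
    the weights need not be probabilities; the binomials are estimated by 2^m instead.\<close>
  define B where "B = frac_series a 1 (\<lambda>m. (2 * \<bar>w\<bar>) ^ m) t"
  have PB: "\<bar>P n\<bar> \<le> B" for n
    unfolding P B_def
  proof (rule frac_series_abs_le)
    fix m
    show "\<bar>(-1) ^ (m - Suc n) * real (m choose Suc n) * w ^ m\<bar> \<le> (2 * \<bar>w\<bar>) ^ m"
      using mult_right_mono[OF choose_le_power2[of m "Suc n"], of "\<bar>w\<bar> ^ m"]
      by (simp add: abs_mult power_abs power_mult_distrib)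
  qed (use a t in \<open>auto intro!: geom_boundedI[of _ 1 "2 * \<bar>w\<bar>"]\<close>)
  have k0: "0 \<le> rl_kernel (b * real l + b) y" for l using b by (intro rl_kernel_nonneg) auto
  \<comment> \<open>The factor l choose n vanishes for n > l, so for fixed l the sum over n is
    finite.\<close>
  have F0: "F n l = 0" if "n \<notin> {..l}" for n l using that by (simp add: F_def g_def)
  have inner: "summable (\<lambda>n. \<bar>F n l\<bar>)" for l
    by (rule summable_finite[of "{..l}"]) (auto simp: F0)
  have le: "(\<Sum>n. \<bar>F n l\<bar>) \<le> B * \<bar>\<sigma>\<bar> * ((2 * \<bar>\<sigma>\<bar>) ^ l * rl_kernel (b * real l + b) y)" for l
  proof -
    have "(\<Sum>n. \<bar>F n l\<bar>) = (\<Sum>n\<le>l. \<bar>F n l\<bar>)" by (rule suminf_finite) (auto simp: F0)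
    also have "\<dots> \<le> (\<Sum>n\<le>l. B * (\<bar>\<sigma>\<bar> * (real (l choose n) * \<bar>\<sigma>\<bar> ^ l) * rl_kernel (b * real l + b) y))"
      using k0 by (intro sum_mono) (auto simp: F_def g_def abs_mult power_abs intro!: mult_right_mono PB)
    also have "\<dots> = B * (\<bar>\<sigma>\<bar> * (real (\<Sum>n\<le>l. l choose n) * \<bar>\<sigma>\<bar> ^ l) * rl_kernel (b * real l + b) y)"
      by (simp add: sum_distrib_left sum_distrib_right)
    \<comment> \<open>The binomials of row l sum to 2^l, which only doubles the geometric
      rate.\<close>
    also have "\<dots> = B * \<bar>\<sigma>\<bar> * ((2 * \<bar>\<sigma>\<bar>) ^ l * rl_kernel (b * real l + b) y)"
      by (simp only: choose_row_sum) (simp add: power_mult_distrib mult_ac)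
    finally show ?thesis .
  qed
  have outer: "summable (\<lambda>l. \<Sum>n. \<bar>F n l\<bar>)"
  proof (rule summable_comparison_test_ev)
    show "summable (\<lambda>l. B * \<bar>\<sigma>\<bar> * ((2 * \<bar>\<sigma>\<bar>) ^ l * rl_kernel (b * real l + b) y))"
      by (intro summable_mult summable_geometric_rl_kernel) (use b y in auto)
    show "\<forall>\<^sub>F l in sequentially. norm (\<Sum>n. \<bar>F n l\<bar>) \<le> B * \<bar>\<sigma>\<bar> * ((2 * \<bar>\<sigma>\<bar>) ^ l * rl_kernel (b * real l + b) y)"
      using le suminf_nonneg[OF inner] by (intro always_eventually) (simp add: abs_of_nonneg)
  qed
  have row: "(\<Sum>l. F n l) = P n * jump_sum_density \<sigma> b (Suc n) y" for n
    unfolding jump_sum_density_frac_series[OF b y] F_def frac_series_def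
    using summable_frac_series(3)[OF gb b _ y, of b n] b
    by (subst suminf_mult) (auto simp: g_def)
  have col: "(\<Sum>n. F n l) = frac_series a 1 (\<lambda>m. compound_coeff w \<sigma> m l) t * rl_kernel (b * real l + b) y" for l
  proof -
    have "(\<Sum>n. F n l) = (\<Sum>n\<le>l. F n l)" by (rule suminf_finite) (auto simp: F0)
    also have "\<dots> = (\<Sum>n\<le>l. g l n * P n) * rl_kernel (b * real l + b) y"
      unfolding F_def sum_distrib_right by (intro sum.cong refl) (simp only: mult_ac)
    also have "(\<Sum>n\<le>l. g l n * P n) =
        (\<Sum>n\<le>l. frac_series a 1 (\<lambda>m. g l n * ((-1) ^ (m - Suc n) * real (m choose Suc n) * w ^ m)) t)"
      unfolding P using a t by (intro sum.cong refl frac_series_cmult[symmetric] geom_bounded_choose) auto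
    also have "\<dots> = frac_series a 1 (\<lambda>m. \<Sum>n\<le>l. g l n * ((-1) ^ (m - Suc n) * real (m choose Suc n) * w ^ m)) t"
      by (intro frac_series_sum geom_bounded_cmult geom_bounded_choose) (use a t in auto)
    also have "\<dots> = frac_series a 1 (\<lambda>m. compound_coeff w \<sigma> m l) t"
    proof (rule frac_series_cong)
      fix m
      have "(\<Sum>n\<le>l. g l n * ((-1) ^ (m - Suc n) * real (m choose Suc n) * w ^ m)) =
          (\<Sum>n\<le>l. (-1) ^ (l - n) * (-1) ^ (m - Suc n) * (real (l choose n) * real (m choose Suc n))) * (w ^ m * \<sigma> ^ (l + 1))"
        unfolding sum_distrib_right by (intro sum.cong refl) (simp add: g_def)
      then show "(\<Sum>n\<le>l. g l n * ((-1) ^ (m - Suc n) * real (m choose Suc n) * w ^ m)) = compound_coeff w \<sigma> m l"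
        unfolding alternating_vandermonde compound_coeff_def by simp
    qed
    finally show ?thesis .
  qed
  show "summable (\<lambda>n. poisson_weight a (w * t powr a) (Suc n) * jump_sum_density \<sigma> b (Suc n) y)"
    using suminf_swap_abs(2)[OF inner outer] unfolding row P_def .
  show "(\<Sum>n. poisson_weight a (w * t powr a) (Suc n) * jump_sum_density \<sigma> b (Suc n) y) =
      frac_series b b (\<lambda>l. frac_series a 1 (\<lambda>m. compound_coeff w \<sigma> m l) t) y"
    using suminf_swap_abs(1)[OF inner outer] unfolding row col P_def frac_series_def by simp
qed

section \<open>Sums of jumps and mixtures of densities\<close>

lemma jump_sum_density_1: "jump_sum_density \<sigma> b (Suc 0) = jump_density \<sigma> b"
proof
  fix y
  have "1 / y * (\<sigma> * y powr b) = \<sigma> * y powr (b - 1)" if "0 < y"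
    using that by (simp add: powr_diff)
  then show "jump_sum_density \<sigma> b (Suc 0) y = jump_density \<sigma> b y"
    by (simp add: jump_sum_density_def jump_density_def mittag_leffler_def)
qed

lemma jump_sum_density_measurable:
  assumes "0 < b"
  shows "jump_sum_density \<sigma> b (Suc n) \<in> borel_measurable borel"
proof -
  have "jump_sum_density \<sigma> b (Suc n) =
      (\<lambda>y. if 0 < y then frac_series b b (\<lambda>l. \<sigma> * ((-1) ^ (l - n) * real (l choose n) * \<sigma> ^ l)) y else 0)"
    using jump_sum_density_frac_series[OF assms] by (auto simp: fun_eq_iff jump_sum_density_def)
  then show ?thesis by simp
qed

text \<open>The signs combine to the constant (-1)^(k-n) wherever the binomial is nonzero. This is
  the Cauchy product of coefficients that occurs when one more jump is added.\<close>

lemma alternating_hockey_stick: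
  "(\<Sum>i\<le>k. (-1) ^ i * ((-1) ^ (k - i - n) * real ((k - i) choose n))) = (-1) ^ (k - n) * real (Suc k choose Suc n)"
proof -
  have "(\<Sum>i\<le>k. (-1) ^ i * ((-1) ^ (k - i - n) * real ((k - i) choose n))) =
      (\<Sum>i\<le>k. (-1) ^ (k - n) * real ((k - i) choose n))"
  proof (rule sum.cong[OF refl])
    fix i assume i: "i \<in> {..k}"
    show "(-1) ^ i * ((-1) ^ (k - i - n) * real ((k - i) choose n)) = (-1) ^ (k - n) * real ((k - i) choose n)"
    proof (cases "n \<le> k - i")
      case True
      have "k - n = i + (k - i - n)" using i True by auto
      then have "(-1 :: real) ^ (k - n) = (-1) ^ i * (-1) ^ (k - i - n)" by (metis power_add)
      then show ?thesis by simp
    qed (simp add: binomial_eq_0)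
  qed
  also have "\<dots> = (-1) ^ (k - n) * real (\<Sum>i\<le>k. (k - i) choose n)" by (simp add: sum_distrib_left)
  also have "(\<Sum>i\<le>k. (k - i) choose n) = (\<Sum>i\<le>k. i choose n)"
    by (rule sum.reindex_bij_witness[of _ "\<lambda>i. k - i" "\<lambda>i. k - i"]) auto
  also have "\<dots> = Suc k choose Suc n" by (rule sum_choose_upper)
  finally show ?thesis .
qed

text \<open>The Cauchy product raises n by one but yields leading index b + b and coefficients
  shifted by one place. The coefficient skipped by the shift is 0, so the series can be moved back
  to leading index \<open>b\<close>.\<close>

lemma jump_sum_density_convolution:
  assumes b: "0 < b"
  shows "has_bochner_integral lborel
    (\<lambda>s. jump_sum_density \<sigma> b (Suc 0) (x - s) * jump_sum_density \<sigma> b (Suc n) s)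
    (jump_sum_density \<sigma> b (Suc (Suc n)) x)"
proof (cases "0 < x")
  case False
  then have 1: "(\<lambda>s. jump_sum_density \<sigma> b (Suc 0) (x - s) * jump_sum_density \<sigma> b (Suc n) s) = (\<lambda>s. 0)"
    and 2: "jump_sum_density \<sigma> b (Suc (Suc n)) x = 0"
    by (auto simp: fun_eq_iff jump_sum_density_def)
  show ?thesis unfolding 1 2 by (rule has_bochner_integral_zero)
next
  case x: True
  define d where "d n l = \<sigma> * ((-1) ^ (l - n) * real (l choose n) * \<sigma> ^ l)" for n l
  have f: "jump_sum_density \<sigma> b (Suc n) y = frac_series b b (d n) y" if "0 < y" for n y
    using jump_sum_density_frac_series[OF b that] unfolding d_def .
  have gb: "geom_bounded (d n)" for n
    unfolding d_def by (intro geom_bounded_cmult geom_bounded_choose)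
  have 1: "(\<lambda>s. jump_sum_density \<sigma> b (Suc 0) (x - s) * jump_sum_density \<sigma> b (Suc n) s) =
    (\<lambda>s. indicator {0<..<x} s *\<^sub>R (frac_series b b (d 0) (x - s) * frac_series b b (d n) s))"
  proof
    fix s
    show "jump_sum_density \<sigma> b (Suc 0) (x - s) * jump_sum_density \<sigma> b (Suc n) s =
      indicator {0<..<x} s *\<^sub>R (frac_series b b (d 0) (x - s) * frac_series b b (d n) s)"
    proof (cases "s \<in> {0<..<x}")
      case True
      then show ?thesis using f[of s n] f[of "x - s" 0] by simp
    qed (auto simp: jump_sum_density_def)
  qed
  have 2: "(\<lambda>k. \<Sum>i\<le>k. d 0 i * d n (k - i)) = (\<lambda>k. d (Suc n) (k + 1))"
  proof
    fix k
    have "(\<Sum>i\<le>k. d 0 i * d n (k - i)) =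
        (\<Sum>i\<le>k. \<sigma> * \<sigma> ^ Suc k * ((-1) ^ i * ((-1) ^ (k - i - n) * real ((k - i) choose n))))"
    proof (rule sum.cong[OF refl])
      fix i assume "i \<in> {..k}"
      then have "\<sigma> ^ Suc k = \<sigma> * (\<sigma> ^ i * \<sigma> ^ (k - i))" by (simp add: power_add[symmetric])
      then show "d 0 i * d n (k - i) = \<sigma> * \<sigma> ^ Suc k * ((-1) ^ i * ((-1) ^ (k - i - n) * real ((k - i) choose n)))"
        by (auto simp: d_def)
    qed
    also have "\<dots> = d (Suc n) (k + 1)"
      unfolding sum_distrib_left[symmetric] alternating_hockey_stick by (simp add: d_def)
    finally show "(\<Sum>i\<le>k. d 0 i * d n (k - i)) = d (Suc n) (k + 1)" .
  qed
  have "frac_series b (b + b) (\<lambda>k. d (Suc n) (k + 1)) x = frac_series b b (d (Suc n)) x"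
    using frac_series_shift[OF gb b _ x, of b 1 "Suc n"] b by (simp add: d_def)
  then show ?thesis
    using frac_series_convolution[OF gb[of n] gb[of 0] b b b x] unfolding 1 2 f[OF x] by simp
qed

section \<open>Continuity and pointwise nonnegativity of the densities\<close>

lemma geom_bounded_shift: "geom_bounded d \<Longrightarrow> geom_bounded (\<lambda>k. d (k + n))"
  using geom_bounded_Suc[of "\<lambda>k. d (k + _)"] by (induction n) (simp_all add: geom_bounded_Suc)

text \<open>The derivative rule needs a leading index of at least 1. Enough leading terms are split
  off for the tail to satisfy this, and each of them is a power, continuous away from 0.\<close>

lemma isCont_frac_series:
  assumes d: "geom_bounded d" and c: "0 < c" and e: "0 \<le> e" and u: "0 < u"
  shows "isCont (frac_series c e d) u"
proof -
  obtain n :: nat where "1 \<le> c * real n"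
    using reals_Archimedean3[OF c] by (metis less_imp_le mult.commute)
  then have n: "0 \<le> c * real n + e - 1" using e by simp
  have split: "frac_series c e d v =
      frac_series c (c * real n + e - 1 + 1) (\<lambda>k. d (k + n)) v + (\<Sum>k<n. d k * rl_kernel (c * real k + e) v)"
    if "0 < v" for v
    unfolding frac_series_def
    by (subst suminf_split_initial_segment[OF summable_frac_series(3)[OF d c e that], of n])
      (simp add: algebra_simps)
  have "\<forall>\<^sub>F v in nhds u. v \<in> {0<..}"
    using u by (intro eventually_nhds_in_open) auto
  then have eq: "\<forall>\<^sub>F v in nhds u. frac_series c e d v =
      frac_series c (c * real n + e - 1 + 1) (\<lambda>k. d (k + n)) v + (\<Sum>k<n. d k * rl_kernel (c * real k + e) v)"
    by eventually_elim (simp add: split)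
  have "isCont (rl_kernel r) u" for r
    unfolding rl_kernel_def[abs_def] using u by (intro continuous_intros) auto
  moreover have "isCont (frac_series c (c * real n + e - 1 + 1) (\<lambda>k. d (k + n))) u"
    using frac_series_has_derivative[OF geom_bounded_shift[OF d] c n u] by (rule DERIV_isCont)
  ultimately have "isCont (\<lambda>v. frac_series c (c * real n + e - 1 + 1) (\<lambda>k. d (k + n)) v
      + (\<Sum>k<n. d k * rl_kernel (c * real k + e) v)) u"
    by (intro continuous_intros) auto
  then show ?thesis by (subst isCont_cong[OF eq])
qed

text \<open>A negative value at a point of continuity would persist on an interval, which has
  positive measure.\<close>

lemma AE_lborel_nonneg_isCont:
  fixes f :: "real \<Rightarrow> real"
  assumes ae: "AE x in lborel. 0 \<le> f x" and cont: "isCont f x0"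
  shows "0 \<le> f x0"
proof (rule ccontr)
  assume "\<not> 0 \<le> f x0"
  then have "\<forall>\<^sub>F x in nhds x0. f x < 0"
    using cont order_tendstoD(2)[of f "f x0" "nhds x0" 0] by (simp add: continuous_at tendsto_at_iff_tendsto_nhds)
  then obtain e where e: "0 < e" "\<And>x. dist x x0 < e \<Longrightarrow> f x < 0"
    unfolding eventually_nhds_metric by blast
  from ae have "AE x in lborel. x \<notin> {x0 - e<..<x0 + e}"
  proof eventually_elim
    fix x assume "0 \<le> f x"
    with e(2)[of x] show "x \<notin> {x0 - e<..<x0 + e}" by (auto simp: dist_real_def abs_less_iff)
  qed
  then have "emeasure lborel {x0 - e<..<x0 + e} = 0"
    by (subst (asm) AE_iff_measurable[of "{x0 - e<..<x0 + e}"]) auto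
  with e(1) show False by simp
qed

text \<open>Continuity on the positive half-line removes the exceptional null set, so none has to be
  carried through the convolutions.\<close>

lemma jump_density_nonneg:
  assumes b: "0 < b" and ae: "AE x in lborel. 0 \<le> jump_density \<sigma> b x"
  shows "0 \<le> jump_density \<sigma> b y"
proof (cases "0 < y")
  case True
  define d where "d = (\<lambda>l. \<sigma> * ((-1) ^ (l - 0) * real (l choose 0) * \<sigma> ^ l))"
  have d: "geom_bounded d"
    unfolding d_def by (intro geom_bounded_cmult geom_bounded_choose)
  have f: "jump_density \<sigma> b x = frac_series b b d x" if "0 < x" for x
    using jump_sum_density_frac_series[OF b that, of \<sigma> 0] unfolding d_def jump_sum_density_1 .
  have "\<forall>\<^sub>F x in nhds y. x \<in> {0<..}"
    using True by (intro eventually_nhds_in_open) auto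
  then have "\<forall>\<^sub>F x in nhds y. jump_density \<sigma> b x = frac_series b b d x"
    by eventually_elim (simp add: f)
  then have "isCont (jump_density \<sigma> b) y"
    using isCont_frac_series[OF d b _ True, of b] b by (simp add: isCont_cong)
  then show ?thesis by (rule AE_lborel_nonneg_isCont[OF ae])
qed (simp add: jump_density_def)

lemma jump_sum_density_nonneg:
  assumes b: "0 < b" and ae: "AE x in lborel. 0 \<le> jump_density \<sigma> b x"
  shows "0 \<le> jump_sum_density \<sigma> b (Suc n) y"
proof (induction n arbitrary: y)
  case 0
  then show ?case using jump_density_nonneg[OF b ae] by (simp add: jump_sum_density_1)
next
  case (Suc n)
  have "jump_sum_density \<sigma> b (Suc (Suc n)) y =
      (\<integral>s. jump_sum_density \<sigma> b (Suc 0) (y - s) * jump_sum_density \<sigma> b (Suc n) s \<partial>lborel)"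
    using jump_sum_density_convolution[OF b, of \<sigma> y n] by (simp add: has_bochner_integral_iff)
  also have "\<dots> \<ge> 0"
    using jump_density_nonneg[OF b ae] Suc.IH
    by (intro integral_nonneg_AE AE_I2 mult_nonneg_nonneg) (auto simp: jump_sum_density_1)
  finally show ?case .
qed

text \<open>A further jump is independent of the preceding sum, so the densities convolve. Pointwise
  nonnegativity lets the convolution in extended nonnegative reals be read as the real integral
  already computed.\<close>

lemma (in prob_space) distributed_jump_sum:
  assumes b: "0 < b" and indep: "indep_vars (\<lambda>_. borel) Y {1..}"
    and dens: "\<And>j. 1 \<le> j \<Longrightarrow> has_real_density M (Y j) (jump_density \<sigma> b)"
  shows "distributed M lborel (\<lambda>\<omega>. \<Sum>j = 1..Suc n. Y j \<omega>) (\<lambda>x. ennreal (jump_sum_density \<sigma> b (Suc n) x))"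
proof (induction n)
  case 0
  then show ?case using dens[of 1] by (simp add: has_real_density_def jump_sum_density_1)
next
  case (Suc n)
  have ae: "AE x in lborel. 0 \<le> jump_density \<sigma> b x"
    using dens[of 1] by (simp add: has_real_density_def)
  note nonneg = jump_sum_density_nonneg[OF b ae]
  have "indep_var borel (Y (Suc (Suc n))) borel (\<lambda>\<omega>. \<Sum>j\<in>{1..Suc n}. Y j \<omega>)"
    by (intro indep_vars_sum indep_vars_subset[OF indep]) auto
  moreover have "distributed M lborel (Y (Suc (Suc n))) (\<lambda>x. ennreal (jump_sum_density \<sigma> b (Suc 0) x))"
    using dens[of "Suc (Suc n)"] by (simp add: has_real_density_def jump_sum_density_1)
  ultimately have "distributed M lborel (\<lambda>\<omega>. Y (Suc (Suc n)) \<omega> + (\<Sum>j = 1..Suc n. Y j \<omega>))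
      (\<lambda>x. \<integral>\<^sup>+s. ennreal (jump_sum_density \<sigma> b (Suc 0) (x - s)) * ennreal (jump_sum_density \<sigma> b (Suc n) s) \<partial>lborel)"
    using Suc.IH by (rule distributed_convolution)
  also have "(\<lambda>x. \<integral>\<^sup>+s. ennreal (jump_sum_density \<sigma> b (Suc 0) (x - s)) * ennreal (jump_sum_density \<sigma> b (Suc n) s) \<partial>lborel) =
      (\<lambda>x. ennreal (jump_sum_density \<sigma> b (Suc (Suc n)) x))"
  proof
    fix x
    have "(\<integral>\<^sup>+s. ennreal (jump_sum_density \<sigma> b (Suc 0) (x - s)) * ennreal (jump_sum_density \<sigma> b (Suc n) s) \<partial>lborel) =
        (\<integral>\<^sup>+s. ennreal (jump_sum_density \<sigma> b (Suc 0) (x - s) * jump_sum_density \<sigma> b (Suc n) s) \<partial>lborel)"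
      using nonneg by (simp add: ennreal_mult)
    also have "\<dots> = ennreal (\<integral>s. jump_sum_density \<sigma> b (Suc 0) (x - s) * jump_sum_density \<sigma> b (Suc n) s \<partial>lborel)"
      using jump_sum_density_convolution[OF b, of \<sigma> x n] nonneg
      by (intro nn_integral_eq_integral) (auto simp: has_bochner_integral_iff)
    also have "\<dots> = ennreal (jump_sum_density \<sigma> b (Suc (Suc n)) x)"
      using jump_sum_density_convolution[OF b, of \<sigma> x n] by (simp add: has_bochner_integral_iff)
    finally show "(\<integral>\<^sup>+s. ennreal (jump_sum_density \<sigma> b (Suc 0) (x - s)) * ennreal (jump_sum_density \<sigma> b (Suc n) s) \<partial>lborel) =
      ennreal (jump_sum_density \<sigma> b (Suc (Suc n)) x)" .
  qed
  also have "(\<lambda>\<omega>. Y (Suc (Suc n)) \<omega> + (\<Sum>j = 1..Suc n. Y j \<omega>)) = (\<lambda>\<omega>. \<Sum>j = 1..Suc (Suc n). Y j \<omega>)"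
    by (simp add: fun_eq_iff)
  finally show ?case .
qed

section \<open>Integration of mixtures\<close>

lemma (in prob_space) distributed_real_prob:
  fixes f :: "real \<Rightarrow> real"
  assumes X: "distributed M lborel X (\<lambda>x. ennreal (f x))" and f: "f \<in> borel_measurable borel" "\<And>x. 0 \<le> f x"
    and A: "A \<in> sets borel"
  shows "has_bochner_integral lborel (\<lambda>x. indicator A x *\<^sub>R f x) (prob (X -` A \<inter> space M))"
proof (rule has_bochner_integral_nn_integral)
  have "emeasure M (X -` A \<inter> space M) = (\<integral>\<^sup>+x. ennreal (f x) * indicator A x \<partial>lborel)"
    using distributed_emeasure[OF X] A by simp
  also have "\<dots> = (\<integral>\<^sup>+x. ennreal (indicator A x *\<^sub>R f x) \<partial>lborel)"
    by (intro nn_integral_cong) (auto simp: indicator_def)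
  finally show "(\<integral>\<^sup>+x. ennreal (indicator A x *\<^sub>R f x) \<partial>lborel) = ennreal (prob (X -` A \<inter> space M))"
    by (simp add: emeasure_eq_measure)
  show "(\<lambda>x. indicator A x *\<^sub>R f x) \<in> borel_measurable lborel" using f A by simp
qed (use f in auto)

text \<open>By nonnegativity the n-th term has norm integral \<open>p n * q n\<close>, at most
  \<open>p n\<close>. Summability of the weights alone then justifies exchanging sum and integral,
  without any estimate of the densities.\<close>

lemma integral_nonneg_mixture:
  fixes g :: "nat \<Rightarrow> real \<Rightarrow> real"
  assumes g: "\<And>n. has_bochner_integral lborel (\<lambda>x. indicator A x *\<^sub>R g n x) (q n)"
    and pos: "\<And>n x. 0 \<le> g n x" "\<And>n. 0 \<le> p n"
    and sp: "summable p" and q: "\<And>n. q n \<le> 1"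
    and sums: "\<And>x. (\<lambda>n. p n * g n x) sums f x"
  shows "set_integrable lborel A f" and "(\<lambda>n. p n * q n) sums (LBINT x:A. f x)"
proof -
  define F where "F n x = p n * (indicator A x *\<^sub>R g n x)" for n x
  have F: "has_bochner_integral lborel (F n) (p n * q n)" for n
    unfolding F_def by (intro has_bochner_integral_mult_right g)
  have F0: "0 \<le> F n x" for n x using pos by (simp add: F_def)
  have Fs: "(\<lambda>n. F n x) sums (indicator A x *\<^sub>R f x)" for x
    using sums_mult[OF sums, of "indicator A x"] by (simp add: F_def mult_ac)
  have q0: "0 \<le> q n" for n
  proof -
    have "q n = (\<integral>x. indicator A x *\<^sub>R g n x \<partial>lborel)"
      using g[of n] by (simp add: has_bochner_integral_iff)
    also have "\<dots> \<ge> 0" using pos by (intro integral_nonneg_AE) auto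
    finally show ?thesis .
  qed
  have s: "summable (\<lambda>n. p n * q n)"
    by (rule summable_comparison_test_ev[OF _ sp])
      (use pos q q0 in \<open>auto simp: abs_mult intro!: always_eventually mult_left_le\<close>)
  have 1: "summable (\<lambda>n. \<integral>x. norm (F n x) \<partial>lborel)"
    using s F by (simp add: F0 has_bochner_integral_iff)
  have 2: "AE x in lborel. summable (\<lambda>n. norm (F n x))"
    using Fs by (simp add: F0 sums_iff)
  have 3: "integrable lborel (F n)" for n using F by (simp add: has_bochner_integral_iff)
  have 4: "(\<lambda>x. \<Sum>n. F n x) = (\<lambda>x. indicator A x *\<^sub>R f x)" using Fs by (simp add: sums_iff)
  show "set_integrable lborel A f"
    using integrable_suminf[OF 3 2 1] unfolding 4 set_integrable_def .
  show "(\<lambda>n. p n * q n) sums (LBINT x:A. f x)"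
    using sums_integral[OF 3 2 1] F unfolding 4 set_lebesgue_integral_def by (simp add: has_bochner_integral_iff)
qed

lemma compound_density_sums:
  assumes a: "0 < a" and b: "0 < b" and t1: "0 \<le> t1"
  shows "(\<lambda>n. poisson_weight a (lam * t1 powr a * t2) (Suc n) * jump_sum_density \<sigma> b (Suc n) y) sums
      compound_density lam \<sigma> a b y t1 t2"
    and "0 < y \<Longrightarrow> summable (\<lambda>n. compound_density_term lam \<sigma> a b y t1 t2 (Suc n))"
proof -
  have s: "summable (\<lambda>n. poisson_weight a (lam * t1 powr a * t2) (Suc n) * jump_sum_density \<sigma> b (Suc n) y)"
    if "0 < y"
  \<comment> \<open>The expansion requires a positive time. At t1 = 0 the argument of the weights is
    0, and those of index at least 1 vanish.\<close>
  proof (cases "t1 = 0")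
    case True
    then show ?thesis by (simp add: poisson_weight_def)
  next
    case False
    then show ?thesis using compound_series(1)[OF a b _ that, of t1 "lam * t2"] t1 by (simp add: mult_ac)
  qed
  have term_eq: "compound_density_term lam \<sigma> a b y t1 t2 (Suc n) =
      y * (poisson_weight a (lam * t1 powr a * t2) (Suc n) * jump_sum_density \<sigma> b (Suc n) y)" if "0 < y" for n
    using compound_density_term_eq[OF that] by (simp add: mult_ac)
  show "0 < y \<Longrightarrow> summable (\<lambda>n. compound_density_term lam \<sigma> a b y t1 t2 (Suc n))"
    unfolding term_eq by (intro summable_mult s)
  show "(\<lambda>n. poisson_weight a (lam * t1 powr a * t2) (Suc n) * jump_sum_density \<sigma> b (Suc n) y) sums
      compound_density lam \<sigma> a b y t1 t2"
  proof (cases "0 < y")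
    case True
    then show ?thesis
      using s[OF True] by (simp add: compound_density_def term_eq suminf_mult sums_iff)
  next
    case False
    then show ?thesis by (simp add: compound_density_def jump_sum_density_def)
  qed
qed

section \<open>The compound field\<close>

text \<open>The space is partitioned by the number of jumps; on each piece the random sum has a
  fixed length. Independence enters through two events, pulled back from path space by an evaluation
  and from sequence space by a partial sum.\<close>

lemma (in prob_space) compound_field_prob_sums:
  assumes N: "N t1 t2 \<in> measurable M (count_space UNIV)" and t: "0 \<le> t1" "0 \<le> t2"
    and Y: "\<And>j. 1 \<le> j \<Longrightarrow> Y j \<in> borel_measurable M"
    and indep: "indep_set
          (sets (vimage_algebra (space M) (field_path N) (\<Pi>\<^sub>M t\<in>{0..} \<times> {0..}. count_space UNIV)))
          (sets (vimage_algebra (space M) (\<lambda>\<omega>. \<lambda>j\<in>{1..}. Y j \<omega>) (\<Pi>\<^sub>M j\<in>{1..}. borel)))"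
  shows "(\<lambda>n. prob {\<omega> \<in> space M. N t1 t2 \<omega> = n} * prob {\<omega> \<in> space M. (\<Sum>j = 1..n. Y j \<omega>) \<le> y}) sums
    prob {\<omega> \<in> space M. compound_field N Y t1 t2 \<omega> \<le> (y::real)}"
proof -
  define A where "A n = {\<omega> \<in> space M. N t1 t2 \<omega> = n}" for n
  define B where "B n = {\<omega> \<in> space M. (\<Sum>j = 1..n. Y j \<omega>) \<le> y}" for n
  have "A n = N t1 t2 -` {n} \<inter> space M" for n by (auto simp: A_def)
  then have Am: "A n \<in> sets M" for n using measurable_sets[OF N, of "{n}"] by simp
  have "(\<lambda>\<omega>. \<Sum>j = 1..n. Y j \<omega>) \<in> borel_measurable M" for n
    using Y by (intro borel_measurable_sum) auto
  then have Bm: "B n \<in> sets M" for n unfolding B_def by measurable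
  have AB: "prob (A n \<inter> B n) = prob (A n) * prob (B n)" for n
  proof (rule indep_setD[OF indep])
    define P where "P = (\<Pi>\<^sub>M t\<in>({0..} :: real set) \<times> ({0..} :: real set). count_space (UNIV :: nat set))"
    \<comment> \<open>Evaluation at one point of the index set brings the event that N equals n into
      the \<sigma>-algebra generated by the whole field.\<close>
    have "(\<lambda>g. g (t1, t2)) \<in> measurable P (count_space (UNIV :: nat set))"
      unfolding P_def using t by (intro measurable_component_singleton) auto
    from measurable_sets[OF this, of "{n}"]
    have "field_path N -` ((\<lambda>g. g (t1, t2)) -` {n} \<inter> space P) \<inter> space M
        \<in> sets (vimage_algebra (space M) (field_path N) P)"
      by (intro in_vimage_algebra) simp
    also have "field_path N -` ((\<lambda>g. g (t1, t2)) -` {n} \<inter> space P) \<inter> space M = A n"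
      using t by (auto simp: A_def P_def field_path_def space_PiM)
    finally show "A n \<in> sets (vimage_algebra (space M) (field_path N) (\<Pi>\<^sub>M t\<in>{0..} \<times> {0..}. count_space UNIV))"
      unfolding P_def .
  next
    define P where "P = (\<Pi>\<^sub>M j\<in>{1::nat..}. borel :: real measure)"
    have "(\<lambda>g. \<Sum>j = 1..n. g j) \<in> borel_measurable P"
      unfolding P_def by (intro borel_measurable_sum measurable_component_singleton) auto
    from measurable_sets[OF this, of "{..y}"]
    have "(\<lambda>\<omega>. \<lambda>j\<in>{1..}. Y j \<omega>) -` ((\<lambda>g. \<Sum>j = 1..n. g j) -` {..y} \<inter> space P) \<inter> space M
        \<in> sets (vimage_algebra (space M) (\<lambda>\<omega>. \<lambda>j\<in>{1..}. Y j \<omega>) P)"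
      by (intro in_vimage_algebra) simp
    also have "(\<lambda>\<omega>. \<lambda>j\<in>{1..}. Y j \<omega>) -` ((\<lambda>g. \<Sum>j = 1..n. g j) -` {..y} \<inter> space P) \<inter> space M = B n"
      by (auto simp: B_def P_def space_PiM)
    finally show "B n \<in> sets (vimage_algebra (space M) (\<lambda>\<omega>. \<lambda>j\<in>{1..}. Y j \<omega>) (\<Pi>\<^sub>M j\<in>{1..}. borel))"
      unfolding P_def .
  qed
  have "(\<lambda>n. prob (A n \<inter> B n)) sums prob (\<Union>n. A n \<inter> B n)"
    by (rule finite_measure_UNION) (use Am Bm in \<open>auto simp: disjoint_family_on_def A_def\<close>)
  also have "(\<Union>n. A n \<inter> B n) = {\<omega> \<in> space M. compound_field N Y t1 t2 \<omega> \<le> y}"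
    by (auto simp: A_def B_def compound_field_def)
  finally show ?thesis unfolding AB unfolding A_def B_def .
qed

lemma (in prob_space) prob_nat_sums_1:
  assumes "X \<in> measurable M (count_space (UNIV :: nat set))"
  shows "(\<lambda>n. prob {\<omega> \<in> space M. X \<omega> = n}) sums 1"
proof -
  have eq: "{\<omega> \<in> space M. X \<omega> = n} = X -` {n} \<inter> space M" for n by auto
  have "{\<omega> \<in> space M. X \<omega> = n} \<in> sets M" for n
    unfolding eq using measurable_sets[OF assms, of "{n}"] by simp
  then have "(\<lambda>n. prob {\<omega> \<in> space M. X \<omega> = n}) sums prob (\<Union>n. {\<omega> \<in> space M. X \<omega> = n})"
    by (intro finite_measure_UNION) (auto simp: disjoint_family_on_def)
  also have "(\<Union>n. {\<omega> \<in> space M. X \<omega> = n}) = space M" by auto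
  finally show ?thesis by (simp add: prob_space)
qed

lemma compound_density_equation:
  fixes lam \<sigma> a b y t t2 :: real and f :: "real \<Rightarrow> real \<Rightarrow> real \<Rightarrow> real"
  assumes a: "0 < a" "a \<le> 1" and b: "0 < b" "b \<le> 1" and y: "0 < y" and t: "0 < t"
  defines "f \<equiv> compound_density lam \<sigma> a b"
    and "Dy \<equiv> \<lambda>y t1 t2. caputo_ext b (\<lambda>x. f x t1 t2) y"
  shows "caputo_exists a (\<lambda>s. f y s t2) t"
    and "\<And>s. 0 < s \<Longrightarrow> caputo_ext_exists b (\<lambda>x. f x s t2) y"
    and "caputo_exists a (\<lambda>s. Dy y s t2) t"
    and "\<sigma> * caputo a (\<lambda>s. f y s t2) t = - (lam * t2 * Dy y t t2 + caputo a (\<lambda>s. Dy y s t2) t)"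
proof -
  \<comment> \<open>In the equation \<open>t2\<close> is only a parameter and merges with
    \<open>lam\<close> into one rate.\<close>
  define w where "w = lam * t2"
  define K where "K = compound_coeff w \<sigma>"
  have K: "geom_bounded2 K" unfolding K_def by (rule geom_bounded2_compound_coeff)
  note K' = geom_bounded2_Suc[OF K]
  have b0: "0 \<le> b" using b by simp
  have f: "f x s t2 = frac_series b b (\<lambda>l. frac_series a 1 (\<lambda>m. K m l) s) x" if "0 < x" "0 < s" for x s
  proof -
    have "f x s t2 = (\<Sum>n. poisson_weight a (w * s powr a) (Suc n) * jump_sum_density \<sigma> b (Suc n) x)"
      using compound_density_sums(1)[OF a(1) b(1), of s lam t2 \<sigma> x] that
      by (simp add: f_def sums_iff w_def mult_ac)
    then show ?thesis using compound_series(2)[OF a(1) b(1) that(2,1)] by (simp add: K_def)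
  qed
  have f': "f y s t2 = frac_series a 1 (\<lambda>m. frac_series b b (K m) y) s" if "0 < s" for s
    unfolding f[OF y that] using frac_series_swap[OF K a(1) _ that b(1) b0 y] by simp
  have gy: "geom_bounded (\<lambda>l. frac_series a 1 (\<lambda>m. K m l) s)" if "0 < s" for s
    by (rule geom_bounded_frac_series[OF geom_bounded2_flip[OF K] a(1) _ that]) simp
  \<comment> \<open>The prescribed value at the origin is the constant subtracted in the extended
    derivative.\<close>
  have f0: "f 0 s t2 = 0" for s by (simp add: f_def compound_density_def)
  have ext: "caputo_ext_exists b (\<lambda>x. f x s t2) y"
    "Dy y s t2 = frac_series b b (\<lambda>l. frac_series a 1 (\<lambda>m. K m (Suc l)) s) y" if "0 < s" for s
    unfolding Dy_def
    using caputo_ext_frac_series[OF gy[OF that] b y, of "\<lambda>x. f x s t2"] f[OF _ that] f0 by auto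
  then show "\<And>s. 0 < s \<Longrightarrow> caputo_ext_exists b (\<lambda>x. f x s t2) y" by blast
  have Dy: "Dy y s t2 = frac_series a 1 (\<lambda>m. frac_series b b (\<lambda>l. K m (Suc l)) y) s" if "0 < s" for s
    unfolding ext(2)[OF that] using frac_series_swap[OF K' a(1) _ that b(1) b0 y, of 1] by simp
  have gt: "geom_bounded (\<lambda>m. frac_series b b (K m) y)"
    by (rule geom_bounded_frac_series[OF K b(1) b0 y])
  have gt': "geom_bounded (\<lambda>m. frac_series b b (\<lambda>l. K m (Suc l)) y)"
    by (rule geom_bounded_frac_series[OF K' b(1) b0 y])
  note c1 = caputo_frac_series[OF gt a t, of "\<lambda>s. f y s t2", OF f']
  note c2 = caputo_frac_series[OF gt' a t, of "\<lambda>s. Dy y s t2", OF Dy]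
  show "caputo_exists a (\<lambda>s. f y s t2) t" by (rule c1(1))
  show "caputo_exists a (\<lambda>s. Dy y s t2) t" by (rule c2(1))
  \<comment> \<open>The equation for a single time coefficient: a Caputo derivative in time advances
    \<open>m\<close>, one in space advances \<open>l\<close>.\<close>
  have rec: "\<sigma> * frac_series b b (K (Suc m)) y =
      - (w * frac_series b b (\<lambda>l. K m (Suc l)) y + frac_series b b (\<lambda>l. K (Suc m) (Suc l)) y)" for m
  proof -
    have g: "geom_bounded (\<lambda>l. K m (Suc l))" for m by (rule geom_bounded2_row[OF K'])
    have "\<sigma> * frac_series b b (K (Suc m)) y = frac_series b b (\<lambda>l. \<sigma> * K (Suc m) l) y"
      by (rule frac_series_cmult[symmetric, OF geom_bounded2_row[OF K] b(1) b0 y])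
    also have "\<dots> = frac_series b b (\<lambda>l. (-1) * (w * K m (Suc l) + K (Suc m) (Suc l))) y"
      by (rule frac_series_cong) (simp add: K_def compound_coeff_recurrence)
    also have "\<dots> = (-1) * (w * frac_series b b (\<lambda>l. K m (Suc l)) y + frac_series b b (\<lambda>l. K (Suc m) (Suc l)) y)"
      by (simp only: frac_series_cmult frac_series_add geom_bounded_add geom_bounded_cmult g b b0 y)
    finally show ?thesis by simp
  qed
  note g1 = geom_bounded_Suc[OF gt'] and g2 = gt'
  have "\<sigma> * caputo a (\<lambda>s. f y s t2) t = frac_series a 1 (\<lambda>m. \<sigma> * frac_series b b (K (Suc m)) y) t"
    by (simp only: c1(2) frac_series_cmult geom_bounded_Suc[OF gt] a t zero_le_one)
  also have "\<dots> = frac_series a 1 (\<lambda>m. (-1) * (w * frac_series b b (\<lambda>l. K m (Suc l)) y + frac_series b b (\<lambda>l. K (Suc m) (Suc l)) y)) t"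
    unfolding rec by simp
  also have "\<dots> = (-1) * (w * frac_series a 1 (\<lambda>m. frac_series b b (\<lambda>l. K m (Suc l)) y) t
      + frac_series a 1 (\<lambda>m. frac_series b b (\<lambda>l. K (Suc m) (Suc l)) y) t)"
    by (simp only: frac_series_cmult frac_series_add geom_bounded_add geom_bounded_cmult g1 g2 a t zero_le_one)
  finally show "\<sigma> * caputo a (\<lambda>s. f y s t2) t = - (lam * t2 * Dy y t t2 + caputo a (\<lambda>s. Dy y s t2) t)"
    by (simp add: Dy[OF t] c2(2) w_def)
qed

theorem theorem4p2:
  fixes M :: "'a measure"
    and N :: "real \<Rightarrow> real \<Rightarrow> 'a \<Rightarrow> nat"
    and Y :: "nat \<Rightarrow> 'a \<Rightarrow> real"
    and lam \<sigma> \<alpha>1 \<beta> :: real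
    and f :: "real \<Rightarrow> real \<Rightarrow> real \<Rightarrow> real"
    and Dy :: "real \<Rightarrow> real \<Rightarrow> real \<Rightarrow> real"
  assumes "prob_space M"
    and "0 < lam" and "0 < \<sigma>"
    and "0 < \<alpha>1" and "\<alpha>1 \<le> 1"
    and "0 < \<beta>" and "\<beta> \<le> 1"
    and field: "fractional_poisson_field M lam \<alpha>1 1 N"
    and field_law: "\<And>n t1 t2. 0 \<le> t1 \<Longrightarrow> 0 \<le> t2 \<Longrightarrow>
          measure M {\<omega> \<in> space M. N t1 t2 \<omega> = n} = fractional_poisson_prob lam \<alpha>1 1 n t1 t2"
    and Y_indep: "prob_space.indep_vars M (\<lambda>_. borel) Y {1..}"
    and Y_density: "\<And>j. 1 \<le> j \<Longrightarrow> has_real_density M (Y j) (jump_density \<sigma> \<beta>)"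
    and N_Y_indep: "prob_space.indep_set M
          (sets (vimage_algebra (space M) (field_path N)
             (\<Pi>\<^sub>M t\<in>{0..} \<times> {0..}. count_space UNIV)))
          (sets (vimage_algebra (space M) (\<lambda>\<omega>. \<lambda>j\<in>{1..}. Y j \<omega>)
             (\<Pi>\<^sub>M j\<in>{1..}. borel)))"
  defines "f \<equiv> compound_density lam \<sigma> \<alpha>1 \<beta>"
    and "Dy \<equiv> \<lambda>y t1 t2. caputo_ext \<beta> (\<lambda>x. f x t1 t2) y"
  shows
    "(\<forall>y>0. \<forall>t1\<ge>0. \<forall>t2\<ge>0.
        summable (\<lambda>n. compound_density_term lam \<sigma> \<alpha>1 \<beta> y t1 t2 (Suc n))) \<and>
     (\<forall>y\<ge>0. \<forall>t1\<ge>0. \<forall>t2\<ge>0.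
        set_integrable lborel {..y} (\<lambda>x. f x t1 t2) \<and>
        measure M {\<omega> \<in> space M. compound_field N Y t1 t2 \<omega> \<le> y} =
          mittag_leffler \<alpha>1 1 (- lam * t1 powr \<alpha>1 * t2) * indicator {0..} y
            + (LBINT x:{..y}. f x t1 t2)) \<and>
     (\<forall>y>0. \<forall>t1>0. \<forall>t2\<ge>0.
        caputo_exists \<alpha>1 (\<lambda>s. f y s t2) t1 \<and>
        (\<forall>s>0. caputo_ext_exists \<beta> (\<lambda>x. f x s t2) y) \<and>
        caputo_exists \<alpha>1 (\<lambda>s. Dy y s t2) t1 \<and>
        \<sigma> * caputo \<alpha>1 (\<lambda>s. f y s t2) t1 =
          - (lam * t2 * Dy y t1 t2 + caputo \<alpha>1 (\<lambda>s. Dy y s t2) t1)) \<and>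
     (\<forall>y>0. \<forall>t2\<ge>0. f y 0 t2 = 0) \<and>
     (\<forall>t1\<ge>0. \<forall>t2\<ge>0.
        set_integrable lborel {0..} (\<lambda>y. f y t1 t2) \<and>
        (LBINT y:{0..}. f y t1 t2) = 1 - mittag_leffler \<alpha>1 1 (- lam * t1 powr \<alpha>1 * t2))"
proof -
  interpret prob_space M by fact
  note a = \<open>0 < \<alpha>1\<close> \<open>\<alpha>1 \<le> 1\<close> and b = \<open>0 < \<beta>\<close> \<open>\<beta> \<le> 1\<close>
  define p where "p t1 t2 n = poisson_weight \<alpha>1 (lam * t1 powr \<alpha>1 * t2) n" for t1 t2 n
  define S where "S n \<omega> = (\<Sum>j = 1..n. Y j \<omega>)" for n \<omega>
  define g where "g n = jump_sum_density \<sigma> \<beta> (Suc n)" for n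
  have ae: "AE x in lborel. 0 \<le> jump_density \<sigma> \<beta> x"
    using Y_density[of 1] by (simp add: has_real_density_def)
  have g0: "0 \<le> g n x" for n x unfolding g_def by (rule jump_sum_density_nonneg[OF b(1) ae])
  have gm: "g n \<in> borel_measurable borel" for n
    unfolding g_def by (rule jump_sum_density_measurable[OF b(1)])
  have gS: "has_bochner_integral lborel (\<lambda>x. indicator A x *\<^sub>R g n x) (prob (S (Suc n) -` A \<inter> space M))"
    if "A \<in> sets borel" for A n
    unfolding g_def S_def[abs_def]
    by (rule distributed_real_prob[OF distributed_jump_sum[OF b(1) Y_indep Y_density]])
      (use that gm g0 in \<open>auto simp: g_def\<close>)
  have N: "N t1 t2 \<in> measurable M (count_space UNIV)" if "0 \<le> t1" "0 \<le> t2" for t1 t2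
    using field that by (simp add: fractional_poisson_field_def)
  have Ym: "Y j \<in> borel_measurable M" if "1 \<le> j" for j
    using Y_indep that by (auto simp: indep_vars_def)
  have law: "prob {\<omega> \<in> space M. N t1 t2 \<omega> = n} = p t1 t2 n" if "0 \<le> t1" "0 \<le> t2" for t1 t2 n
    using field_law[OF that] fractional_poisson_prob_eq[OF a(1) that(2)] by (simp add: p_def)
  have p0: "0 \<le> p t1 t2 n" if "0 \<le> t1" "0 \<le> t2" for t1 t2 n
    using law[OF that, of n] measure_nonneg by metis
  \<comment> \<open>Normalisation follows from countable additivity, since \<open>N\<close> has
    natural values; no identity between Mittag-Leffler functions is summed.\<close>
  have psums: "p t1 t2 sums 1" if "0 \<le> t1" "0 \<le> t2" for t1 t2
    using prob_nat_sums_1[OF N[OF that]] unfolding law[OF that] .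
  have psums': "(\<lambda>n. p t1 t2 (Suc n)) sums (1 - p t1 t2 0)" if "0 \<le> t1" "0 \<le> t2" for t1 t2
    using psums[OF that] by (simp add: sums_Suc_iff)
  have p_0: "p t1 t2 0 = mittag_leffler \<alpha>1 1 (- lam * t1 powr \<alpha>1 * t2)" for t1 t2
    by (simp add: p_def poisson_weight_def mittag_leffler_def)
  have fsums: "(\<lambda>n. p t1 t2 (Suc n) * g n y) sums f y t1 t2" if "0 \<le> t1" for t1 t2 y
    unfolding p_def g_def f_def by (rule compound_density_sums(1)[OF a(1) b(1) that])
  have mix: "set_integrable lborel A (\<lambda>x. f x t1 t2)"
    "(\<lambda>n. p t1 t2 (Suc n) * prob (S (Suc n) -` A \<inter> space M)) sums (LBINT x:A. f x t1 t2)"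
    if "0 \<le> t1" "0 \<le> t2" "A \<in> sets borel" for t1 t2 A
    by (rule integral_nonneg_mixture[OF gS[OF that(3)] g0 p0[OF that(1,2)] sums_summable[OF psums'[OF that(1,2)]]
          prob_le_1 fsums[OF that(1)]])+
  have cdf: "measure M {\<omega> \<in> space M. compound_field N Y t1 t2 \<omega> \<le> y} =
      mittag_leffler \<alpha>1 1 (- lam * t1 powr \<alpha>1 * t2) * indicator {0..} y + (LBINT x:{..y}. f x t1 t2)"
    if "0 \<le> y" "0 \<le> t1" "0 \<le> t2" for y t1 t2
  proof -
    have S: "S n -` {..y} \<inter> space M = {\<omega> \<in> space M. (\<Sum>j = 1..n. Y j \<omega>) \<le> y}" for n
      by (auto simp: S_def)
    have "(\<lambda>n. p t1 t2 n * prob (S n -` {..y} \<inter> space M)) sums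
        prob {\<omega> \<in> space M. compound_field N Y t1 t2 \<omega> \<le> y}"
      using compound_field_prob_sums[OF N that(2,3) Ym N_Y_indep, of y] that
      unfolding law[OF that(2,3)] S by blast
    moreover have "(\<lambda>n. p t1 t2 n * prob (S n -` {..y} \<inter> space M)) sums
        ((LBINT x:{..y}. f x t1 t2) + p t1 t2 0 * prob (S 0 -` {..y} \<inter> space M))"
      using mix(2)[OF that(2,3), of "{..y}"] by (subst sums_Suc_iff[symmetric]) simp
    \<comment> \<open>The empty sum is 0, hence at most \<open>y\<close>. The term n = 0 therefore
      contributes its full weight, the atom of the law at 0.\<close>
    moreover have "S 0 -` {..y} \<inter> space M = space M" using that by (auto simp: S_def)
    ultimately show ?thesis using that by (auto simp: p_0 prob_space dest: sums_unique2)
  qed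
  have total: "(LBINT y:{0..}. f y t1 t2) = 1 - mittag_leffler \<alpha>1 1 (- lam * t1 powr \<alpha>1 * t2)"
    if "0 \<le> t1" "0 \<le> t2" for t1 t2
  proof -
    have "prob (S (Suc n) -` {0..} \<inter> space M) = 1" for n
    proof -
      \<comment> \<open>The densities vanish on the negative half-line, so restriction to
        \<open>{0..}\<close> loses no mass.\<close>
      have "(\<lambda>x. indicator {0..} x *\<^sub>R g n x) = (\<lambda>x. indicator UNIV x *\<^sub>R g n x)"
        by (auto simp: fun_eq_iff indicator_def g_def jump_sum_density_def)
      then have "prob (S (Suc n) -` {0..} \<inter> space M) = prob (S (Suc n) -` UNIV \<inter> space M)"
        using gS[of "{0..}" n] gS[of UNIV n] by (auto simp: has_bochner_integral_iff)
      then show ?thesis by (simp add: prob_space)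
    qed
    then have "(\<lambda>n. p t1 t2 (Suc n)) sums (LBINT x:{0..}. f x t1 t2)"
      using mix(2)[OF that, of "{0..}"] by simp
    then show ?thesis using psums'[OF that] p_0 by (metis sums_unique2)
  qed
  have at0: "f y 0 t2 = 0" for y t2
    using fsums[of 0 t2 y] by (simp add: p_def poisson_weight_def sums_iff)
  have summ: "summable (\<lambda>n. compound_density_term lam \<sigma> \<alpha>1 \<beta> y t1 t2 (Suc n))"
    if "0 < y" "0 \<le> t1" for y t1 t2
    by (rule compound_density_sums(2)[OF a(1) b(1) that(2,1)])
  note pde = compound_density_equation[OF a b, where lam = lam and \<sigma> = \<sigma>, folded f_def]
  show ?thesis
    unfolding Dy_def by (intro conjI allI impI) (use summ mix(1) cdf pde at0 total in auto)
qed

end
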